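(* Let $A\subset\mathbb{R}^2$ be a finite set with $|A|=n$ and with no $k$ collinear points (where $k\ge 2$ is an integer). Let $\Gamma\subset\mathbb{RP}^2$ be a real projective cubic and set \[ s:=|A\setminus \Gamma|,\qquad m:=|A\cap\Gamma|=n-s. \] Assume $m>3(k-1)$. Then $\Gamma$ is not a union of three real lines, and the following hold. \begin{enumerate} \item[(i)] If $\Gamma=Q\cup L$, where $Q$ is an irreducible real conic and $L$ is a real line, and if $a:=|A\cap L|$, then \[ \vartheta_A(A\cap Q)\le s+a+1 \] and hence \[ \omega(V(A))\ge \frac{|A\cap Q|}{s+a+1} \ge \frac{n-s-(k-1)}{s+k}. \] Moreover $A\cap\Gamma$ can be partitioned into at most $s+2a+1\le s+2k-1$ subsets each of which is mutually visible in $A$. \item[(ii)] If $\Gamma$ is irreducible, then $A\cap\Gamma$ can be partitioned into at most $15(s+1)+13$ subsets each of which is mutually visible in $A$, and \[ \omega(V(A))\ge \frac{n-s-13}{15(s+1)}. \] \end{enumerate} Consequently, \[ \omega(V(A))\ge \max\left\{1, \min\left( \frac{n-s-(k-1)}{s+k}, \frac{n-s-13}{15(s+1)} \right)\right\}. \]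
   Context: The affine plane $\mathbb{R}^2$ is regarded as a subset of its projective closure $\mathbb{RP}^2$; for a projective curve $\Gamma$, $A\cap\Gamma$ means the points of $A$ lying on $\Gamma$. A real projective cubic is the zero locus in $\mathbb{RP}^2$ of a nonzero real homogeneous polynomial of degree $3$; over $\mathbb{R}$ it is (up to multiplicity) either irreducible, a real line together with an irreducible real conic, or a union of three real lines (not necessarily distinct). For $p,q\in\mathbb{R}^2$, $(pq)^\circ$ denotes the open segment joining them. Two points $p,q$ of a finite set $A\subset\mathbb{R}^2$ are visible in $A$ if $(pq)^\circ$ contains no point of $A$; a subset of $A$ is mutually visible (in $A$) if every two of its points are visible in $A$. The visibility graph $V(A)$ has vertex set $A$ and edges the visible pairs, and $\omega(V(A))$ is its clique number (the largest size of a mutually visible subset of $A$). For $Y\subseteq A$, $\vartheta_A(Y)$ denotes the least number of parts in a partition of $Y$ into subsets that are mutually visible in the ambient set $A$. *)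

theory Defs
  imports
    "HOL-Analysis.Analysis"
    "HOL-Computational_Algebra.Factorial_Ring"
    "HOL-Library.Poly_Mapping"
    "HOL-Library.Disjoint_Sets"
    "HOL-Library.Ramsey"
begin

section \<open>Plane projective curves over the reals\<close>

text \<open>The polynomial ring in three indeterminates over the reals: finitely supported maps from
  exponent vectors to coefficients, with the convolution product.\<close>

type_synonym poly3 = "(3 \<Rightarrow>\<^sub>0 nat) \<Rightarrow>\<^sub>0 real"

definition eval3 :: "poly3 \<Rightarrow> real ^ 3 \<Rightarrow> real" where
  "eval3 F v = (\<Sum>e \<in> Poly_Mapping.keys F. Poly_Mapping.lookup F e *
     (\<Prod>i \<in> UNIV. (v $ i) ^ Poly_Mapping.lookup e i))"

definition homogeneous3 :: "nat \<Rightarrow> poly3 \<Rightarrow> bool" where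
  "homogeneous3 d F \<longleftrightarrow>
     (\<forall>e \<in> Poly_Mapping.keys F. (\<Sum>i \<in> UNIV. Poly_Mapping.lookup e i) = d)"

text \<open>Points of the real projective plane are the lines through the origin of three-space.\<close>

typedef rp2 = "{S :: (real ^ 3) set. subspace S \<and> dim S = 1}"
proof
  show "span {axis 1 1 :: real ^ 3} \<in> {S. subspace S \<and> dim S = 1}"
    by (simp add: dim_span dim_singleton axis_eq_0_iff)
qed

definition of_affine :: "real ^ 2 \<Rightarrow> rp2" where
  "of_affine p = Abs_rp2 (span {vector [p $ 1, p $ 2, 1]})"

text \<open>Only used for homogeneous polynomials, which vanish at every vector representing a
  projective point as soon as they vanish at one nonzero representative.\<close>

definition zero_locus :: "poly3 \<Rightarrow> rp2 set" where
  "zero_locus F = {P. \<forall>v \<in> Rep_rp2 P. eval3 F v = 0}"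

definition projective_curve :: "nat \<Rightarrow> rp2 set \<Rightarrow> bool" where
  "projective_curve d C \<longleftrightarrow> (\<exists>F. F \<noteq> 0 \<and> homogeneous3 d F \<and> C = zero_locus F)"

text \<open>Irreducibility is that of a defining form in the polynomial ring over the reals, not over
  the complex numbers, and not topological irreducibility of the zero set.\<close>

definition irreducible_projective_curve :: "nat \<Rightarrow> rp2 set \<Rightarrow> bool" where
  "irreducible_projective_curve d C \<longleftrightarrow>
     (\<exists>F. irreducible F \<and> homogeneous3 d F \<and> C = zero_locus F)"

abbreviation projective_line :: "rp2 set \<Rightarrow> bool" where
  "projective_line \<equiv> projective_curve 1"

abbreviation projective_cubic :: "rp2 set \<Rightarrow> bool" where
  "projective_cubic \<equiv> projective_curve 3"

abbreviation irreducible_conic :: "rp2 set \<Rightarrow> bool" where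
  "irreducible_conic \<equiv> irreducible_projective_curve 2"

abbreviation irreducible_cubic :: "rp2 set \<Rightarrow> bool" where
  "irreducible_cubic \<equiv> irreducible_projective_curve 3"

definition points_on :: "(real ^ 2) set \<Rightarrow> rp2 set \<Rightarrow> (real ^ 2) set" where
  "points_on A C = {p \<in> A. of_affine p \<in> C}"


section \<open>Visibility\<close>

definition visible :: "(real ^ 2) set \<Rightarrow> real ^ 2 \<Rightarrow> real ^ 2 \<Rightarrow> bool" where
  "visible A p q \<longleftrightarrow> open_segment p q \<inter> A = {}"

definition mutually_visible :: "(real ^ 2) set \<Rightarrow> (real ^ 2) set \<Rightarrow> bool" where
  "mutually_visible A B \<longleftrightarrow> B \<subseteq> A \<and> (\<forall>p \<in> B. \<forall>q \<in> B. p \<noteq> q \<longrightarrow> visible A p q)"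

text \<open>A graph is a pair of a vertex set and a set of two-element edges.\<close>

definition visibility_graph :: "(real ^ 2) set \<Rightarrow> (real ^ 2) set \<times> (real ^ 2) set set" where
  "visibility_graph A = (A, {{p, q} |p q. p \<in> A \<and> q \<in> A \<and> p \<noteq> q \<and> visible A p q})"

text \<open>Meaningful for graphs with finitely many vertices.\<close>

definition clique_number :: "'a set \<times> 'a set set \<Rightarrow> nat" where
  "clique_number G = Max (card ` {C. C \<subseteq> fst G \<and> clique C (snd G)})"

definition visible_partition :: "(real ^ 2) set \<Rightarrow> (real ^ 2) set \<Rightarrow> (real ^ 2) set set \<Rightarrow> bool" where
  "visible_partition A Y P \<longleftrightarrow>
     finite P \<and> partition_on Y P \<and> (\<forall>B \<in> P. mutually_visible A B)"

definition visible_partition_number :: "(real ^ 2) set \<Rightarrow> (real ^ 2) set \<Rightarrow> nat" where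
  "visible_partition_number A Y = (LEAST t. \<exists>P. visible_partition A Y P \<and> card P = t)"

end

theory Submission imports Defs begin

text \<open>Let \<open>X\<close> be a set of points on a curve such that no open chord of \<open>X\<close> meets the curve. A chord of
  \<open>X\<close> can then only be blocked by a point of \<open>A\<close> off the curve, and such a point blocks at most one
  chord at each point of \<open>X\<close>. The graph of invisible pairs has degree at most the number of these
  blockers, and greedy colouring gives that number plus one visible classes. On an irreducible conic
  all points form such a set \<open>X\<close>.

  An irreducible cubic splits, up to 13 points, into 15 such sets. It has a real point at infinity;
  after a change of coordinates (affine, or projective and separating the half planes) its equation is
  \<open>y\<^sup>2 + B(x) y + C(x) = 0\<close> with \<open>deg B \<le> 2\<close> and \<open>deg C \<le> 3\<close>, apart from the case of the graph of a
  rational function. The branches of this curve are governed by the quartic discriminant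
  \<open>D = B\<^sup>2 - 4 C\<close>, and they are cut at the zeros of \<open>D\<close>, at one further line and at the at most seven
  flexes.\<close>

section \<open>Positivity components of a quartic\<close>

text \<open>Irreducibility enters only through the fact that a line meets the curve in finitely many
  points, so singular cubics need no separate treatment. A chord between two points of one branch
  can meet the same branch again, which forces a flex in between, or the other branch, which the
  sign pattern of a cubic with three simple roots on the chord line excludes. What remains is a
  count of cuts. The number of components to the left, the side of the axis and the number of flexes
  to the left are all nondecreasing in the abscissa. They can therefore be added instead of paired:
  equal sums force equal summands, and the colours needed are one more than the sum of the maxima,
  not a product. The sides are separated because the projective change of coordinates preserves
  segments only within a half plane. The exceptional points are at most 4 in the monic case, at most
  5 after the projective change and none for graphs, which is well within 13.\<close>

lemma poly_sign_alternation_bound: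
  fixes D :: "real poly"
  assumes deg: "degree D \<le> 4"
    and less: "x0 < z1" "z1 < x1" "x1 < z2" "z2 < x2" "x2 < z3" "z3 < x3"
    and pos: "poly D x0 > 0" "poly D x1 > 0" "poly D x2 > 0" "poly D x3 > 0"
    and nonpos: "poly D z1 \<le> 0" "poly D z2 \<le> 0" "poly D z3 \<le> 0"
  shows False
proof -
  \<comment> \<open>\<open>D\<close> may merely touch zero at the points \<open>z1\<close>,
    \<open>z2\<close>, \<open>z3\<close>. Lowering it by half of its smallest value at the other
    points turns the weak alternation into strict sign changes.\<close>
  define \<eta> where "\<eta> = Min {poly D x0, poly D x1, poly D x2, poly D x3} / 2"
  define E where "E = D - [:\<eta>:]"
  have \<eta>: "0 < \<eta>" "\<eta> < poly D x0" "\<eta> < poly D x1" "\<eta> < poly D x2" "\<eta> < poly D x3"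
    using pos unfolding \<eta>_def by (auto simp: min_def)
  have E: "poly E x0 > 0" "poly E x1 > 0" "poly E x2 > 0" "poly E x3 > 0"
    "poly E z1 < 0" "poly E z2 < 0" "poly E z3 < 0"
    using \<eta> nonpos by (auto simp: E_def)
  obtain u1 where u1: "x0 < u1" "u1 < z1" "poly E u1 = 0"
    using poly_IVT_neg[OF less(1) E(1,5)] by blast
  obtain u2 where u2: "z1 < u2" "u2 < x1" "poly E u2 = 0"
    using poly_IVT_pos[OF less(2) E(5,2)] by blast
  obtain u3 where u3: "x1 < u3" "u3 < z2" "poly E u3 = 0"
    using poly_IVT_neg[OF less(3) E(2,6)] by blast
  obtain u4 where u4: "z2 < u4" "u4 < x2" "poly E u4 = 0"
    using poly_IVT_pos[OF less(4) E(6,3)] by blast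
  obtain u5 where u5: "x2 < u5" "u5 < z3" "poly E u5 = 0"
    using poly_IVT_neg[OF less(5) E(3,7)] by blast
  have "E \<noteq> 0" using E(1) by auto
  have "degree E \<le> 4" unfolding E_def by (intro degree_diff_le deg) simp
  have "card {u1, u2, u3, u4, u5} = 5"
    using u1 u2 u3 u4 u5 by simp
  moreover have "card {u1, u2, u3, u4, u5} \<le> card {x. poly E x = 0}"
    using u1 u2 u3 u4 u5 \<open>E \<noteq> 0\<close> by (intro card_mono) (auto simp: poly_roots_finite)
  moreover have "card {x. poly E x = 0} \<le> degree E"
    by (rule card_poly_roots_bound) fact
  ultimately show False using \<open>degree E \<le> 4\<close> by linarith
qed

text \<open>The set where a quartic is positive has at most three components; \<open>sign_level\<close> numbers
  them from left to right.\<close>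

definition sign_level :: "real poly \<Rightarrow> real \<Rightarrow> nat" where
  "sign_level D x =
     of_bool (\<exists>x0 z1. x0 < z1 \<and> z1 < x \<and> poly D x0 > 0 \<and> poly D z1 \<le> 0) +
     of_bool (\<exists>x0 z1 x1 z2. x0 < z1 \<and> z1 < x1 \<and> x1 < z2 \<and> z2 < x
        \<and> poly D x0 > 0 \<and> poly D z1 \<le> 0 \<and> poly D x1 > 0 \<and> poly D z2 \<le> 0)"

lemma sign_level_le: "sign_level D x \<le> 2"
  by (simp add: sign_level_def)

lemma sign_level_mono: assumes "x \<le> y" shows "sign_level D x \<le> sign_level D y"
  using assms unfolding sign_level_def
  by (intro add_mono) (auto simp only: of_bool_def split: if_splits intro: less_le_trans, 
      (meson less_le_trans le0 order_refl)+)

lemma sign_level_less: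
  assumes deg: "degree D \<le> 4" and "x < z" "z < y" "poly D x > 0" "poly D y > 0" "poly D z \<le> 0"
  shows "sign_level D x < sign_level D y"
proof -
  let ?P1 = "\<lambda>x. \<exists>x0 z1. x0 < z1 \<and> z1 < x \<and> poly D x0 > 0 \<and> poly D z1 \<le> 0"
  let ?P2 = "\<lambda>x. \<exists>x0 z1 x1 z2. x0 < z1 \<and> z1 < x1 \<and> x1 < z2 \<and> z2 < x
        \<and> poly D x0 > 0 \<and> poly D z1 \<le> 0 \<and> poly D x1 > 0 \<and> poly D z2 \<le> 0"
  have y: "?P1 y" using assms by blast
  \<comment> \<open>Two gaps before \<open>x\<close>, followed by \<open>z\<close> and
    \<open>y\<close>, would give four positive values separated by three nonpositive ones.\<close>
  have x: "\<not> ?P2 x"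
    using poly_sign_alternation_bound[OF deg] assms by blast
  have "?P1 x \<Longrightarrow> ?P2 y" using assms by blast
  with x y show ?thesis by (auto simp only: sign_level_def of_bool_def split: if_splits)
qed

text \<open>Rolle twice. Applied to the difference of an arc and its chord, it turns a third point
  of the arc on the chord into a flex.\<close>

lemma second_derivative_zero:
  fixes f f' f'' :: "real \<Rightarrow> real"
  assumes "a < b" "b < c" "f a = 0" "f b = 0" "f c = 0"
    and f: "\<And>x. a \<le> x \<Longrightarrow> x \<le> c \<Longrightarrow> (f has_real_derivative f' x) (at x)"
    and f': "\<And>x. a \<le> x \<Longrightarrow> x \<le> c \<Longrightarrow> (f' has_real_derivative f'' x) (at x)"
  obtains x where "a < x" "x < c" "f'' x = 0"
proof -
  obtain u where u: "a < u" "u < b" "f b - f a = (b - a) * f' u"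
    using MVT2[OF \<open>a < b\<close>, of f f'] f assms by force
  obtain v where v: "b < v" "v < c" "f c - f b = (c - b) * f' v"
    using MVT2[OF \<open>b < c\<close>, of f f'] f assms by force
  have "u < v" using u v by simp
  then obtain x where x: "u < x" "x < v" "f' v - f' u = (v - u) * f'' x"
    using MVT2[of u v f' f''] f' u v by force
  show ?thesis by (rule that[of x]) (use u v x assms in auto)
qed

text \<open>By Rolle, \<open>P' = D G\<close> vanishes between two zeros of \<open>P\<close>. At
  that point either \<open>D\<close> is nonpositive and the level rises, or a root of
  \<open>G\<close> is passed. Hence \<kappa> increases strictly along the zeros, and they are
  counted against the degree of \<open>G\<close> instead of that of \<open>P\<close>.\<close>

lemma card_zeros_between_level:
  fixes D P G :: "real poly"
  assumes deg: "degree D \<le> 4" and P: "pderiv P = D * G" and "G \<noteq> 0"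
  shows "finite {x. poly D x > 0 \<and> poly P x = 0}"
    "card {x. poly D x > 0 \<and> poly P x = 0} \<le> 3 + degree G"
proof -
  let ?F = "{x. poly D x > 0 \<and> poly P x = 0}"
  define R where "R = {x. poly G x = 0}"
  define \<kappa> where "\<kappa> x = sign_level D x + card {g \<in> R. g < x}" for x
  have R: "finite R" "card R \<le> degree G"
    using \<open>G \<noteq> 0\<close> by (auto simp: R_def poly_roots_finite card_poly_roots_bound)
  have less: "\<kappa> x < \<kappa> y" if xy: "x \<in> ?F" "y \<in> ?F" "x < y" for x y
  proof -
    have 1: "sign_level D x \<le> sign_level D y" using xy by (intro sign_level_mono) auto
    have 2: "card {g \<in> R. g < x} \<le> card {g \<in> R. g < y}"
      using R xy by (intro card_mono) auto
    obtain z where z: "x < z" "z < y" "poly (pderiv P) z = 0"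
      using poly_MVT[OF \<open>x < y\<close>, of P] xy by auto
    show ?thesis
    proof (cases "poly D z \<le> 0")
      case True
      with sign_level_less[OF deg z(1,2)] xy 2 show ?thesis by (auto simp: \<kappa>_def)
    next
      case False
      with z P have "z \<in> R" by (auto simp: R_def)
      then have "z \<in> {g \<in> R. g < y}" "z \<notin> {g \<in> R. g < x}" using z by auto
      moreover have "{g \<in> R. g < x} \<subseteq> {g \<in> R. g < y}" using \<open>x < y\<close> by auto
      ultimately have "{g \<in> R. g < x} \<subset> {g \<in> R. g < y}" by blast
      then have "card {g \<in> R. g < x} < card {g \<in> R. g < y}"
        using R by (intro psubset_card_mono) auto
      with 1 show ?thesis by (simp add: \<kappa>_def)
    qed
  qed
  have inj: "inj_on \<kappa> ?F"
    by (rule linorder_inj_onI') (use less in force)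
  have "\<kappa> x < 3 + degree G" for x
    using sign_level_le[of D x] card_mono[OF R(1), of "{g \<in> R. g < x}"] R(2)
    by (auto simp: \<kappa>_def)
  then have sub: "\<kappa> ` ?F \<subseteq> {..<3 + degree G}" by auto
  show "finite ?F" using inj sub finite_imageD finite_subset by blast
  show "card ?F \<le> 3 + degree G"
    using card_inj_on_le[OF inj sub] by simp
qed

lemma cubic_three_roots:
  fixes g :: "real poly"
  assumes "degree g \<le> 3" "g \<noteq> 0" "poly g a = 0" "poly g b = 0" "poly g c = 0"
    "a \<noteq> b" "a \<noteq> c" "b \<noteq> c"
  obtains k where "k \<noteq> 0" "\<And>t. poly g t = k * ((t - a) * (t - b) * (t - c))"
proof -
  obtain g1 where g1: "g = [:-a, 1:] * g1" using assms by (metis poly_eq_0_iff_dvd dvdE)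
  have "poly g1 b = 0" "poly g1 c = 0" using assms by (auto simp: g1)
  then obtain g2 where g2: "g1 = [:-b, 1:] * g2" by (metis poly_eq_0_iff_dvd dvdE)
  have "poly g2 c = 0" using \<open>poly g1 c = 0\<close> assms by (auto simp: g2)
  then obtain g3 where g3: "g2 = [:-c, 1:] * g3" by (metis poly_eq_0_iff_dvd dvdE)
  have nz: "g3 \<noteq> 0" using assms(2) by (auto simp: g1 g2 g3)
  have "degree g = 3 + degree g3"
    using nz by (simp add: g1 g2 g3 degree_mult_eq del: mult_pCons_left)
  with assms have "degree g3 = 0" by simp
  then obtain k where k: "g3 = [:k:]" by (metis degree_eq_zeroE)
  show ?thesis by (rule that[of k]) (use nz in \<open>auto simp: g1 g2 g3 k algebra_simps\<close>)
qed

section \<open>Flexes of the two branches\<close>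

definition flex_poly :: "real poly \<Rightarrow> real poly" where
  "flex_poly D = smult 2 (D * pderiv (pderiv D)) - (pderiv D)\<^sup>2"

text \<open>Up to a positive factor, \<open>flex_poly D\<close> is the second derivative of \<open>sqrt D\<close>, so these are the
  points where the second derivative of \<open>\<epsilon> * sqrt D\<close> equals \<open>\<beta>\<close>.\<close>

definition flexes :: "real poly \<Rightarrow> real \<Rightarrow> real \<Rightarrow> real set" where
  "flexes D \<beta> \<epsilon> =
     {x. poly D x > 0 \<and> \<epsilon> * poly (flex_poly D) x = 4 * \<beta> * (poly D x * sqrt (poly D x))}"

text \<open>The terms in \<open>D' D''\<close> cancel. The factor \<open>D\<close> left over is what
  makes the counting of zeros by components of \<open>D > 0\<close> possible.\<close>

lemma pderiv_flex_poly: "pderiv (flex_poly D) = D * smult 2 (pderiv (pderiv (pderiv D)))"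
proof -
  have "poly (pderiv (flex_poly D)) = poly (D * smult 2 (pderiv (pderiv (pderiv D))))"
    unfolding flex_poly_def pderiv_diff pderiv_smult pderiv_mult power2_eq_square
      poly_diff poly_mult poly_smult poly_power poly_add
    by (rule ext, algebra)
  then show ?thesis by (simp only: poly_eq_poly_eq_iff)
qed

lemma deriv_sqrt_poly:
  assumes "poly D x > 0"
  shows "((\<lambda>x. sqrt (poly D x)) has_real_derivative
      poly (pderiv D) x / (2 * sqrt (poly D x))) (at x)"
  using DERIV_chain2[OF DERIV_real_sqrt[OF assms] poly_DERIV] by (simp add: field_simps)

lemma deriv2_sqrt_poly:
  assumes "poly D x > 0"
  shows "((\<lambda>x. poly (pderiv D) x / (2 * sqrt (poly D x))) has_real_derivative
      poly (flex_poly D) x / (4 * (poly D x * sqrt (poly D x)))) (at x)"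
proof -
  define r where "r = sqrt (poly D x)"
  have r: "r > 0" "poly D x = r * r" using assms by (auto simp: r_def)
  have "((\<lambda>x. poly (pderiv D) x / (2 * sqrt (poly D x))) has_real_derivative
     (poly (pderiv (pderiv D)) x * (2 * r) - poly (pderiv D) x * (2 * (poly (pderiv D) x / (2 * r))))
       / ((2 * r) * (2 * r))) (at x)"
    unfolding r_def
    by (intro DERIV_divide[OF poly_DERIV DERIV_cmult[OF deriv_sqrt_poly[OF assms]]])
      (use assms in simp)
  also have "(poly (pderiv (pderiv D)) x * (2 * r) - poly (pderiv D) x * (2 * (poly (pderiv D) x / (2 * r))))
       / ((2 * r) * (2 * r)) = poly (flex_poly D) x / (4 * (r * r * r))"
    using r(1) by (simp add: flex_poly_def r(2) divide_simps power2_eq_square)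
  finally show ?thesis using r by (simp add: r_def[symmetric])
qed

text \<open>Where \<open>D > 0\<close> the right-hand side of the flex equation is nonzero, so the
  sign of \<open>flex_poly D\<close> determines \<epsilon>.\<close>

lemma flexes_disjoint:
  assumes "\<beta> \<noteq> 0" shows "flexes D \<beta> 1 \<inter> flexes D \<beta> (-1) = {}"
  using assms by (auto simp: flexes_def)

text \<open>Squaring the equation of the flexes gives \<open>P = 0\<close> with \<open>P = N\<^sup>2 - 64 e\<^sup>2 D\<^sup>3\<close>, of degree up to 9.
  The count of 7 for both branches together comes from the factorization \<open>P' = D G\<close>, where \<open>G\<close> has
  degree at most 4: \<open>P\<close> is injective between the roots of \<open>G\<close> in a component of \<open>D > 0\<close>.\<close>

lemma card_flexes_nondegenerate:
  fixes q0 q1 e r0 r1 :: real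
  assumes e: "e \<noteq> 0" and r: "[:r0, r1:] \<noteq> 0"
    and D: "D = [:q0, q1, e:]\<^sup>2 + [:r0, r1:]"
  shows "card (flexes D (2 * e) 1) + card (flexes D (2 * e) (-1)) \<le> 7"
    and "finite (flexes D (2 * e) 1)" "finite (flexes D (2 * e) (-1))"
proof -
  define N where "N = flex_poly D"
  \<comment> \<open>The factor \<open>64 e^2\<close> is the square of \<open>4 * \<beta>\<close> for
    \<open>\<beta> = 2 * e\<close>.\<close>
  define P where "P = N\<^sup>2 - smult (64 * e\<^sup>2) (D ^ 3)"
  define G where "G = smult 4 (N * pderiv (pderiv (pderiv D)) - smult (48 * e\<^sup>2) (D * pderiv D))"
  have dN: "pderiv N = D * smult 2 (pderiv (pderiv (pderiv D)))"
    by (simp add: N_def pderiv_flex_poly)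
  have "poly (pderiv P) = poly (D * G)"
    unfolding P_def G_def pderiv_diff pderiv_smult pderiv_mult dN power2_eq_square power3_eq_cube
      poly_diff poly_mult poly_smult poly_power poly_add
    by (rule ext, algebra)
  then have PG: "pderiv P = D * G" by (simp only: poly_eq_poly_eq_iff)
  have D': "D = [:q0\<^sup>2 + r0, 2 * q0 * q1 + r1, q1\<^sup>2 + 2 * q0 * e, 2 * q1 * e, e\<^sup>2:]"
    by (simp add: D power2_eq_square algebra_simps)
  have D1: "pderiv D = [:2 * q0 * q1 + r1, 2 * q1\<^sup>2 + 4 * q0 * e, 6 * q1 * e, 4 * e\<^sup>2:]"
    by (simp add: D' pderiv_pCons)
  have D2: "pderiv (pderiv D) = [:2 * q1\<^sup>2 + 4 * q0 * e, 12 * q1 * e, 12 * e\<^sup>2:]"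
    by (simp add: D1 pderiv_pCons)
  have D3: "pderiv (pderiv (pderiv D)) = [:12 * q1 * e, 24 * e\<^sup>2:]"
    by (simp add: D2 pderiv_pCons)
  \<comment> \<open>Both summands have degree 7. With \<open>D\<close> written as a square plus a
    linear remainder, the coefficients of degree 5 to 7 cancel, and those of degree 4 and 3 vanish
    together only if \<open>r1\<close> and \<open>r0\<close> do.\<close>
  have "poly (N * pderiv (pderiv (pderiv D)) - smult (48 * e\<^sup>2) (D * pderiv D)) x = poly
    [:48 * q1^3 * e * r0 - 48 * q0 * q1^2 * e * r1 - 12 * q1 * e * r1^2 - 48 * q0^2 * e^2 * r1 - 48 * e^2 * r0 * r1,
      288 * q1^2 * e^2 * r0 - 288 * q0 * q1 * e^2 * r1 - 72 * e^2 * r1^2,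
      576 * q1 * e^3 * r0 - 288 * q0 * e^3 * r1,
      384 * e^4 * r0 + 96 * q1 * e^3 * r1,
      144 * e^4 * r1:] x" (is "_ = poly ?G x") for x
    unfolding N_def flex_poly_def poly_diff poly_mult poly_smult poly_power D3
    unfolding D2 unfolding D1
    unfolding D' poly_pCons poly_0
    by (simp add: algebra_simps power2_eq_square power3_eq_cube power4_eq_xxxx)
  then have "N * pderiv (pderiv (pderiv D)) - smult (48 * e\<^sup>2) (D * pderiv D) = ?G"
    by (rule poly_eq_poly_eq_iff[THEN iffD1, OF ext])
  then have G_eq: "G = smult 4 ?G" by (simp only: G_def)
  have "degree G \<le> 4" unfolding G_eq by simp
  have "G \<noteq> 0"
  proof
    assume "G = 0"
    then have "coeff G 4 = 0" "coeff G 3 = 0" by simp_all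
    then have "r1 = 0" "r0 = 0" using e by (simp_all add: G_eq numeral_eq_Suc)
    with r show False by simp
  qed
  note G = \<open>degree G \<le> 4\<close> \<open>G \<noteq> 0\<close>
  have "degree D \<le> 4" by (simp add: D')
  note F = card_zeros_between_level[OF this PG G(2)]
  let ?Z = "{x. poly D x > 0 \<and> poly P x = 0}"
  have sub: "flexes D (2 * e) \<epsilon> \<subseteq> ?Z" if "\<epsilon>\<^sup>2 = 1" for \<epsilon>
  proof
    fix x assume "x \<in> flexes D (2 * e) \<epsilon>"
    then have x: "poly D x > 0"
      "\<epsilon> * poly N x = 4 * (2 * e) * (poly D x * sqrt (poly D x))"
      by (auto simp: flexes_def N_def)
    have "(poly N x)\<^sup>2 = (\<epsilon> * poly N x)\<^sup>2" using that by (simp add: power_mult_distrib)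
    also have "\<dots> = 64 * e\<^sup>2 * poly D x ^ 3"
      using x(1) unfolding x(2)
      by (simp add: power_mult_distrib power2_eq_square power3_eq_cube)
    finally show "x \<in> ?Z" using x(1) by (simp add: P_def)
  qed
  show fin: "finite (flexes D (2 * e) 1)" "finite (flexes D (2 * e) (-1))"
    using sub[of 1] sub[of "-1"] F(1) by (auto intro: finite_subset)
  show "card (flexes D (2 * e) 1) + card (flexes D (2 * e) (-1)) \<le> 7"
  proof -
    have "card (flexes D (2 * e) 1) + card (flexes D (2 * e) (-1))
        = card (flexes D (2 * e) 1 \<union> flexes D (2 * e) (-1))"
      using fin e by (intro card_Un_disjoint[symmetric] flexes_disjoint) auto
    also have "\<dots> \<le> card ?Z"
      using sub[of 1] sub[of "-1"] F(1) by (intro card_mono) auto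
    finally show ?thesis using F(2) G(1) by linarith
  qed
qed

text \<open>By the quadratic formula, \<open>y = (W - B) / 2\<close> would solve the equation
  identically, and its graph would be a line inside the curve.\<close>

lemma discriminant_not_square:
  fixes B C W :: "real poly"
  assumes line: "\<And>l. degree l \<le> 1 \<Longrightarrow> finite {t. (poly l t)\<^sup>2 + poly B t * poly l t + poly C t = 0}"
    and "degree (W - B) \<le> 1"
  shows "B\<^sup>2 - smult 4 C \<noteq> W\<^sup>2"
proof
  assume eq: "B\<^sup>2 - smult 4 C = W\<^sup>2"
  define l where "l = smult (1 / 2) (W - B)"
  have "(poly l t)\<^sup>2 + poly B t * poly l t + poly C t = 0" for t
  proof -
    have "(poly B t)\<^sup>2 - 4 * poly C t = (poly W t)\<^sup>2"
      using arg_cong[OF eq, of "\<lambda>p. poly p t"] by simp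
    then show ?thesis by (simp add: l_def power2_eq_square field_simps)
  qed
  then have "infinite {t. (poly l t)\<^sup>2 + poly B t * poly l t + poly C t = 0}"
    by (simp add: infinite_UNIV_char_0)
  then show False using line[of l] assms(2) by (simp add: l_def)
qed

text \<open>The branches are \<open>y = (-B + \<epsilon> sqrt D) / 2\<close>, so
  \<open>y'' = 0\<close> means \<open>\<epsilon> (sqrt D)'' = B'' = 2 b2\<close>; this is the origin
  of the argument \<open>2 * b2\<close>. The cases distinguish whether \<open>D\<close> is quartic,
  cubic or of lower degree.\<close>

lemma card_flexes_le:
  fixes b0 b1 b2 c0 c1 c2 c3 :: real
  defines "B \<equiv> [:b0, b1, b2:]" and "C \<equiv> [:c0, c1, c2, c3:]"
  defines "D \<equiv> B\<^sup>2 - smult 4 C"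
  assumes line: "\<And>l. degree l \<le> 1 \<Longrightarrow> finite {t. (poly l t)\<^sup>2 + poly B t * poly l t + poly C t = 0}"
  shows "finite (flexes D (2 * b2) 1)" "finite (flexes D (2 * b2) (-1))"
    "card (flexes D (2 * b2) 1) + card (flexes D (2 * b2) (-1)) \<le> 7"
proof -
  have nsq: "D \<noteq> W\<^sup>2" if "degree (W - B) \<le> 1" for W
    unfolding D_def using line that by (rule discriminant_not_square)
  have D: "D = [:b0\<^sup>2 - 4 * c0, 2 * b0 * b1 - 4 * c1, b1\<^sup>2 + 2 * b0 * b2 - 4 * c2,
      2 * b1 * b2 - 4 * c3, b2\<^sup>2:]"
    by (simp add: D_def B_def C_def power2_eq_square algebra_simps)
  have "finite (flexes D (2 * b2) 1) \<and> finite (flexes D (2 * b2) (-1)) \<and>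
    card (flexes D (2 * b2) 1) + card (flexes D (2 * b2) (-1)) \<le> 7"
  proof (cases "b2 = 0")
    case False
    \<comment> \<open>\<open>[:q0, q1, b2:]\<close> is the polynomial part of a square root of
      \<open>D\<close>. Its leading coefficient is \<open>b2\<close> and not \<open>-b2\<close>, so
      that it differs from \<open>B\<close> by degree at most 1 and a zero remainder contradicts
      \<open>nsq\<close>.\<close>
    define q1 where "q1 = (2 * b1 * b2 - 4 * c3) / (2 * b2)"
    define q0 where "q0 = (b1\<^sup>2 + 2 * b0 * b2 - 4 * c2 - q1\<^sup>2) / (2 * b2)"
    define r1 where "r1 = 2 * b0 * b1 - 4 * c1 - 2 * q0 * q1"
    define r0 where "r0 = b0\<^sup>2 - 4 * c0 - q0\<^sup>2"
    have q: "2 * (q1 * b2) = 2 * b1 * b2 - 4 * c3"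
      "2 * (q0 * b2) = b1\<^sup>2 + 2 * b0 * b2 - 4 * c2 - q1\<^sup>2"
      using False by (simp_all add: q1_def q0_def)
    have Dq: "D = [:q0, q1, b2:]\<^sup>2 + [:r0, r1:]"
      using q by (simp add: D r0_def r1_def power2_eq_square algebra_simps)
    have "[:r0, r1:] \<noteq> 0"
    proof
      assume "[:r0, r1:] = 0"
      with Dq have "D = [:q0, q1, b2:]\<^sup>2" by (simp only: add_0_right)
      moreover have "degree ([:q0, q1, b2:] - B) \<le> 1" by (simp add: B_def)
      ultimately show False using nsq by blast
    qed
    from card_flexes_nondegenerate[OF False this Dq] show ?thesis by blast
  next
    case b2: True
    show ?thesis
    proof (cases "c3 = 0")
      case False
      have D': "D = [:b0\<^sup>2 - 4 * c0, 2 * b0 * b1 - 4 * c1, b1\<^sup>2 - 4 * c2, - 4 * c3:]"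
        by (simp add: D b2)
      \<comment> \<open>For \<open>b2 = 0\<close> both flex sets are the zeros of
        \<open>flex_poly D\<close> in \<open>D > 0\<close>. As \<open>D\<close> is cubic, the
        cofactor \<open>G\<close> is constant; this gives at most 3 zeros, each counted for both
        branches.\<close>
      define G where "G = smult 2 (pderiv (pderiv (pderiv D)))"
      have G: "G = [:-48 * c3:]" by (simp add: G_def D' pderiv_pCons)
      let ?Z = "{x. poly D x > 0 \<and> poly (flex_poly D) x = 0}"
      have "degree D \<le> 4" by (simp add: D')
      note Z = card_zeros_between_level[OF this, of "flex_poly D" G]
      have Z: "finite ?Z" "card ?Z \<le> 3"
        using Z False by (simp_all add: G_def[symmetric] pderiv_flex_poly) (simp_all add: G)
      have "flexes D (2 * b2) 1 = ?Z" "flexes D (2 * b2) (-1) = ?Z"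
        by (auto simp: flexes_def b2)
      with Z show ?thesis by simp
    next
      case c3: True
      define d0 d1 d2 where "d0 = b0\<^sup>2 - 4 * c0" and "d1 = 2 * b0 * b1 - 4 * c1"
        and "d2 = b1\<^sup>2 - 4 * c2"
      have D': "D = [:d0, d1, d2:]"
        by (simp add: D b2 c3 d0_def d1_def d2_def)
      \<comment> \<open>For \<open>D\<close> of degree at most 2, \<open>flex_poly D\<close> is
        constant, namely minus the discriminant. If it is zero and \<open>D\<close> is positive
        somewhere, then \<open>D\<close> is the square of a polynomial of degree at most 1.\<close>
      have False if x: "poly D x > 0" "poly (flex_poly D) x = 0" for x
      proof -
        have "poly (flex_poly D) x = 4 * d0 * d2 - d1\<^sup>2"
          by (simp add: flex_poly_def D' pderiv_pCons power2_eq_square algebra_simps)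
        with x have disc: "4 * d0 * d2 = d1\<^sup>2" by simp
        have "d2 * poly D x = (d2 * x + d1 / 2)\<^sup>2"
          using disc by (simp add: D' power2_eq_square algebra_simps)
        then have "d2 * poly D x \<ge> 0" by simp
        with x(1) have "d2 \<ge> 0" by (simp add: zero_le_mult_iff)
        show False
        proof (cases "d2 = 0")
          case True
          with disc have "d1 = 0" by simp
          with True have "D = [:d0:]" by (simp add: D')
          with x(1) have "D = [:sqrt d0:]\<^sup>2" by (simp add: power2_eq_square)
          moreover have "degree ([:sqrt d0:] - B) \<le> 1" by (simp add: B_def b2)
          ultimately show False using nsq by blast
        next
          case False
          with \<open>d2 \<ge> 0\<close> have d2: "d2 > 0" by simp
          let ?W = "[:d1 / (2 * sqrt d2), sqrt d2:]"
          have "d1 * d1 / (4 * d2) = d0" using disc d2 by (simp add: power2_eq_square field_simps)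
          then have "D = ?W\<^sup>2" using d2 by (simp add: D' power2_eq_square)
          moreover have "degree (?W - B) \<le> 1" by (simp add: B_def b2)
          ultimately show False using nsq by blast
        qed
      qed
      then have "flexes D (2 * b2) 1 = {}" "flexes D (2 * b2) (-1) = {}"
        by (auto simp: flexes_def b2)
      then show ?thesis by simp
    qed
  qed
  then show "finite (flexes D (2 * b2) 1)" "finite (flexes D (2 * b2) (-1))"
    "card (flexes D (2 * b2) 1) + card (flexes D (2 * b2) (-1)) \<le> 7" by blast+
qed

text \<open>Put \<open>W = 2 l + B\<close>, so that \<open>W\<^sup>2 - D\<close> is four times the restriction of the equation to the line.
  If \<open>r\<close> lies on the other branch, \<open>W\<close> vanishes on both sides of \<open>r\<close>, where the cubic \<open>W\<^sup>2 - D\<close> is then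
  negative although it changes sign at its simple root \<open>r\<close>. If \<open>r\<close> lies on the same branch, Rolle
  produces a flex.\<close>

lemma no_zero_on_branch_chord:
  fixes b0 b1 b2 c0 c1 c2 c3 \<epsilon> :: real and l :: "real poly"
  defines "B \<equiv> [:b0, b1, b2:]" and "C \<equiv> [:c0, c1, c2, c3:]"
  defines "D \<equiv> B\<^sup>2 - smult 4 C"
  assumes l: "degree l \<le> 1" "finite {t. (poly l t)\<^sup>2 + poly B t * poly l t + poly C t = 0}"
    and less: "p < r" "r < q"
    and zero: "(poly l p)\<^sup>2 + poly B p * poly l p + poly C p = 0"
      "(poly l q)\<^sup>2 + poly B q * poly l q + poly C q = 0"
      "(poly l r)\<^sup>2 + poly B r * poly l r + poly C r = 0"
    and \<epsilon>: "\<epsilon> = 1 \<or> \<epsilon> = -1"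
    and branch: "\<epsilon> * (2 * poly l p + poly B p) > 0" "\<epsilon> * (2 * poly l q + poly B q) > 0"
    and D: "\<And>t. p \<le> t \<Longrightarrow> t \<le> q \<Longrightarrow> poly D t > 0"
    and flex: "\<And>t. p < t \<Longrightarrow> t < q \<Longrightarrow> t \<notin> flexes D (2 * b2) \<epsilon>"
  shows False
proof -
  define W where "W = smult 2 l + B"
  define g where "g = W\<^sup>2 - D"
  have g: "poly g t = 4 * ((poly l t)\<^sup>2 + poly B t * poly l t + poly C t)" for t
    by (simp add: g_def W_def D_def power2_eq_square algebra_simps)
  obtain l0 l1 where l01: "l = [:l0, l1:]"
  proof
    show "l = [:coeff l 0, coeff l 1:]"
      using l(1) by (intro poly_eqI) (auto simp: coeff_pCons coeff_eq_0 split: nat.split)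
  qed
  have "g = [:4*l0^2 + 4*b0*l0 + 4*c0, 8*l0*l1 + 4*b0*l1+4*b1*l0+4*c1,
     4*l1^2+4*b1*l1+4*b2*l0+4*c2, 4*b2*l1+4*c3:]"
    by (simp add: g_def W_def D_def B_def C_def l01 power2_eq_square algebra_simps)
  then have "degree g \<le> 3" by simp
  have "g \<noteq> 0"
  proof
    assume "g = 0"
    then have "(poly l t)\<^sup>2 + poly B t * poly l t + poly C t = 0" for t
      using g[of t] by (metis poly_0 mult_eq_0_iff zero_neq_numeral)
    then have "{t. (poly l t)\<^sup>2 + poly B t * poly l t + poly C t = 0} = UNIV"
      by auto
    with l(2) show False by (simp add: infinite_UNIV_char_0)
  qed
  have W2: "(poly W t)\<^sup>2 = poly D t" if "poly g t = 0" for t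
    using that by (simp add: g_def)
  have root: "poly g p = 0" "poly g q = 0" "poly g r = 0" using zero by (simp_all add: g)
  show False
  proof (cases "\<epsilon> * poly W r > 0")
    case False
    have "poly W r \<noteq> 0" using W2[OF root(3)] D[of r] less by auto
    then have Wr: "\<epsilon> * poly W r < 0" using False \<epsilon> by auto
    have Wpq: "\<epsilon> * poly W p > 0" "\<epsilon> * poly W q > 0" using branch by (simp_all add: W_def)
    have "poly W p * poly W r < 0" "poly W r * poly W q < 0"
      using Wr Wpq \<epsilon> by (auto simp: mult_less_0_iff)
    then obtain z1 z2 where z: "p < z1" "z1 < r" "poly W z1 = 0" "r < z2" "z2 < q" "poly W z2 = 0"
      using poly_IVT[OF less(1), of W] poly_IVT[OF less(2), of W] by blast
    then have neg: "poly g z1 < 0" "poly g z2 < 0"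
      using D less by (auto simp: g_def)
    obtain k where k: "k \<noteq> 0" "\<And>t. poly g t = k * ((t - p) * (t - r) * (t - q))"
      using cubic_three_roots[OF \<open>degree g \<le> 3\<close> \<open>g \<noteq> 0\<close> root(1,3,2)] less by auto
    have "(z1 - p) * (z1 - r) * (z1 - q) > 0"
      using z less by (intro mult_neg_neg mult_pos_neg) auto
    with neg(1) have "k < 0" unfolding k(2) by (metis mult_less_0_iff order_less_asym)
    moreover have "(z2 - p) * (z2 - r) * (z2 - q) < 0"
      using z less by (intro mult_pos_neg mult_pos_pos) auto
    ultimately have "poly g z2 > 0" unfolding k(2) by (rule mult_neg_neg)
    with neg show False by simp
  next
    case True
    have eq: "poly W t = \<epsilon> * sqrt (poly D t)" if "poly g t = 0" "\<epsilon> * poly W t > 0" for t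
      using W2[OF that(1), symmetric] that(2) \<epsilon> by (auto simp: real_sqrt_abs)
    let ?f = "\<lambda>t. poly W t - \<epsilon> * sqrt (poly D t)"
    let ?f' = "\<lambda>t. poly (pderiv W) t - \<epsilon> * (poly (pderiv D) t / (2 * sqrt (poly D t)))"
    let ?f'' = "\<lambda>t. poly (pderiv (pderiv W)) t
        - \<epsilon> * (poly (flex_poly D) t / (4 * (poly D t * sqrt (poly D t))))"
    obtain t where t: "p < t" "t < q" "?f'' t = 0"
    proof (rule second_derivative_zero[of p r q ?f ?f' ?f''])
      show "?f p = 0" "?f r = 0" "?f q = 0"
        using eq root True branch by (simp_all add: W_def)
      fix t assume "p \<le> t" "t \<le> q"
      then have "poly D t > 0" by (rule D)
      then show "(?f has_real_derivative ?f' t) (at t)" "(?f' has_real_derivative ?f'' t) (at t)"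
        by (intro DERIV_diff poly_DERIV DERIV_cmult deriv_sqrt_poly deriv2_sqrt_poly; simp)+
    qed (use less in auto)
    \<comment> \<open>As \<open>l\<close> has degree at most 1, the chord does not contribute and
      \<open>W'' = B''\<close>.\<close>
    have "pderiv (pderiv W) = [:2 * b2:]"
      by (simp add: W_def B_def l01 pderiv_pCons pderiv_add pderiv_smult)
    moreover have "poly D t > 0" using D t by simp
    ultimately have "t \<in> flexes D (2 * b2) \<epsilon>"
      using t(3) by (simp add: flexes_def field_simps)
    with flex t show False by blast
  qed
qed

text \<open>The colour of a point is its branch together with the number of components and of flexes of
  its branch to its left and its side of the axis. Branch \<open>\<epsilon>\<close> uses \<open>4 + card (F \<epsilon>)\<close> colours, hence
  both use at most \<open>8 + 7\<close>. The exceptional points are those with vertical tangent or multiplicity.\<close>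

lemma arc_colouring_monic:
  fixes b0 b1 b2 c0 c1 c2 c3 :: real and S :: "(real \<times> real) set"
  defines "B \<equiv> [:b0, b1, b2:]" and "C \<equiv> [:c0, c1, c2, c3:]"
  defines "Z \<equiv> {p. (snd p)\<^sup>2 + poly B (fst p) * snd p + poly C (fst p) = 0}"
  assumes S: "finite S" "S \<subseteq> Z"
    and line: "\<And>l. degree l \<le> 1 \<Longrightarrow> finite {t. (poly l t)\<^sup>2 + poly B t * poly l t + poly C t = 0}"
  obtains T c where "T \<subseteq> S" "card T \<le> 4" "\<And>p. p \<in> S - T \<Longrightarrow> c p < (15 :: nat)"
    "\<And>p q. p \<in> S - T \<Longrightarrow> q \<in> S - T \<Longrightarrow> p \<noteq> q \<Longrightarrow> c p = c q \<Longrightarrow>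
       (fst p > 0 \<longleftrightarrow> fst q > 0) \<and> open_segment p q \<inter> Z = {}"
proof -
  define D where "D = B\<^sup>2 - smult 4 C"
  define F where "F = flexes D (2 * b2)"
  have line': "finite {t. (poly l t)\<^sup>2 + poly [:b0, b1, b2:] t * poly l t + poly [:c0, c1, c2, c3:] t = 0}"
    if "degree l \<le> 1" for l
    using line[OF that] by (simp only: B_def C_def)
  have finF: "finite (F 1)" "finite (F (-1))" and cardF: "card (F 1) + card (F (-1)) \<le> 7"
    using card_flexes_le[OF line'] by (simp_all only: F_def D_def B_def C_def)
  define T where "T = {p \<in> S. poly D (fst p) = 0}"
  define \<epsilon> :: "real \<times> real \<Rightarrow> real"
    where "\<epsilon> p = (if 2 * snd p + poly B (fst p) > 0 then 1 else -1)" for p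
  define \<kappa> where "\<kappa> e t = sign_level D t + of_bool (t > 0) + card {f \<in> F e. f < t}" for e t
  define c where "c p = \<kappa> (\<epsilon> p) (fst p) + (if \<epsilon> p = 1 then 0 else 4 + card (F 1))" for p
  have D_eq: "D = [:b0\<^sup>2 - 4 * c0, 2 * b0 * b1 - 4 * c1, b1\<^sup>2 + 2 * b0 * b2 - 4 * c2,
      2 * b1 * b2 - 4 * c3, b2\<^sup>2:]"
    by (simp add: D_def B_def C_def power2_eq_square algebra_simps)
  then have degD: "degree D \<le> 4" by simp
  have square: "(2 * snd p + poly B (fst p))\<^sup>2 = poly D (fst p)" if "p \<in> Z" for p
  proof -
    have "(2 * snd p + poly B (fst p))\<^sup>2 - poly D (fst p)
        = 4 * ((snd p)\<^sup>2 + poly B (fst p) * snd p + poly C (fst p))"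
      by (simp add: D_def power2_eq_square algebra_simps)
    with that show ?thesis by (simp add: Z_def)
  qed
  have \<kappa>_less: "\<kappa> e t < 4 + card (F e)" if "e = 1 \<or> e = -1" for e t
    using sign_level_le[of D t] card_mono[of "F e" "{f \<in> F e. f < t}"] finF that
    by (auto simp: \<kappa>_def of_bool_def split: if_splits)
  show ?thesis
  proof (rule that[of T c])
    show "T \<subseteq> S" by (auto simp: T_def)
    have "D \<noteq> 0"
    proof
      assume "D = 0"
      then have "b2 = 0" by (simp add: D_eq)
      \<comment> \<open>A vanishing \<open>D\<close> is the square of \<open>W = 0\<close>, which
        the absence of lines on the curve forbids.\<close>
      then have "degree (0 - B) \<le> 1" by (simp add: B_def)
      from discriminant_not_square[OF line this] \<open>D = 0\<close> show False by (simp add: D_def)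
    qed
    \<comment> \<open>Over a root of \<open>D\<close> the quadratic in \<open>y\<close> has only the
      solution \<open>-B / 2\<close>, so each root of the quartic contributes at most one
      exceptional point.\<close>
    have "inj_on fst T"
    proof (rule inj_onI)
      fix p q assume pq: "p \<in> T" "q \<in> T" "fst p = fst q"
      then have "(2 * snd p + poly B (fst p))\<^sup>2 = 0" "(2 * snd q + poly B (fst p))\<^sup>2 = 0"
        using square[of p] square[of q] S by (auto simp: T_def)
      then show "p = q" using pq by (simp add: prod_eq_iff)
    qed
    then have "card T \<le> card {x. poly D x = 0}"
      by (rule card_inj_on_le) (auto simp: T_def poly_roots_finite \<open>D \<noteq> 0\<close>)
    also have "\<dots> \<le> degree D" by (rule card_poly_roots_bound) fact
    finally show "card T \<le> 4" using degD by simp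
    show "c p < 15" if "p \<in> S - T" for p
      using \<kappa>_less[of 1 "fst p"] \<kappa>_less[of "-1" "fst p"] cardF by (auto simp: c_def \<epsilon>_def)
    have ordered: "(fst p > 0 \<longleftrightarrow> fst q > 0) \<and> open_segment p q \<inter> Z = {}"
      if p: "p \<in> S - T" and q: "q \<in> S - T" and pq: "fst p < fst q" and c: "c p = c q" for p q
    proof -
      have Z: "p \<in> Z" "q \<in> Z" using p q S by auto
      have "poly D (fst p) \<noteq> 0" "poly D (fst q) \<noteq> 0" using p q by (auto simp: T_def)
      moreover have "poly D (fst p) \<ge> 0" "poly D (fst q) \<ge> 0"
        using square[OF Z(1)] square[OF Z(2)] by (metis zero_le_power2)+
      ultimately have Dpq: "poly D (fst p) > 0" "poly D (fst q) > 0" by simp_all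
      have nz: "2 * snd p + poly B (fst p) \<noteq> 0" "2 * snd q + poly B (fst q) \<noteq> 0"
        using square[OF Z(1)] square[OF Z(2)] Dpq by auto
      define e where "e = \<epsilon> p"
      have e: "e = 1 \<or> e = -1" by (simp add: e_def \<epsilon>_def)
      have "\<epsilon> q = e"
        using \<kappa>_less[of 1 "fst p"] \<kappa>_less[of 1 "fst q"] c
        by (auto simp: c_def e_def \<epsilon>_def split: if_splits)
      then have \<kappa>: "\<kappa> e (fst p) = \<kappa> e (fst q)" using c by (simp add: c_def e_def)
      have mono: "sign_level D (fst p) \<le> sign_level D (fst q)"
        "of_bool (fst p > 0) \<le> (of_bool (fst q > 0) :: nat)"
        "card {f \<in> F e. f < fst p} \<le> card {f \<in> F e. f < fst q}"
        using pq finF e by (auto intro!: sign_level_mono card_mono)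
      \<comment> \<open>The summands can only grow from \<open>p\<close> to \<open>q\<close>, so
        equality of the sums forces equality of each.\<close>
      have level: "sign_level D (fst p) = sign_level D (fst q)"
        and half: "of_bool (fst p > 0) = (of_bool (fst q > 0) :: nat)"
        and flex_card: "card {f \<in> F e. f < fst p} = card {f \<in> F e. f < fst q}"
        using \<kappa> mono unfolding \<kappa>_def by linarith+
      have flex_eq: "{f \<in> F e. f < fst p} = {f \<in> F e. f < fst q}"
        using flex_card pq finF e by (intro card_subset_eq) auto
      have Dpos: "poly D t > 0" if "fst p \<le> t" "t \<le> fst q" for t
      proof (rule ccontr)
        assume "\<not> poly D t > 0"
        moreover from this Dpq have "t \<noteq> fst p" "t \<noteq> fst q" by auto
        ultimately show False
          using sign_level_less[OF degD, of "fst p" t "fst q"] that Dpq level by auto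
      qed
      have "r \<notin> Z" if r: "r \<in> open_segment p q" for r
      proof
        assume "r \<in> Z"
        obtain u where u: "0 < u" "u < 1" "r = (1 - u) *\<^sub>R p + u *\<^sub>R q"
          using r by (auto simp: in_segment)
        define m where "m = (snd q - snd p) / (fst q - fst p)"
        define l where "l = [:snd p - m * fst p, m:]"
        have m: "m * (fst q - fst p) = snd q - snd p" using pq by (simp add: m_def)
        have lp: "poly l (fst p) = snd p" by (simp add: l_def algebra_simps)
        have lq: "poly l (fst q) = snd q" using m by (simp add: l_def algebra_simps)
        have fr: "fst r = fst p + u * (fst q - fst p)" and sr: "snd r = snd p + u * (snd q - snd p)"
          by (simp_all add: u(3) algebra_simps)
        have lr: "poly l (fst r) = snd r"
          unfolding fr sr m[symmetric] by (simp add: l_def algebra_simps)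
        have "0 < u * (fst q - fst p)" using u pq by simp
        then have "fst p < fst r" by (simp add: fr)
        have "u * (fst q - fst p) < 1 * (fst q - fst p)"
          using u(2) pq by (intro mult_strict_right_mono) auto
        then have "fst r < fst q" by (simp add: fr)
        show False
        proof (rule no_zero_on_branch_chord[of l b0 b1 b2 c0 c1 c2 c3 "fst p" "fst r" "fst q" e])
          show "degree l \<le> 1" by (simp add: l_def)
          then show "finite {t. (poly l t)\<^sup>2 + poly [:b0, b1, b2:] t * poly l t + poly [:c0, c1, c2, c3:] t = 0}"
            by (rule line')
          show "e * (2 * poly l (fst p) + poly [:b0, b1, b2:] (fst p)) > 0"
            "e * (2 * poly l (fst q) + poly [:b0, b1, b2:] (fst q)) > 0"
            using nz \<open>\<epsilon> q = e\<close> e_def by (auto simp: lp lq \<epsilon>_def B_def[symmetric] split: if_splits)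
          show "t \<notin> flexes ([:b0, b1, b2:]\<^sup>2 - smult 4 [:c0, c1, c2, c3:]) (2 * b2) e"
            if t: "fst p < t" "t < fst q" for t
          proof
            assume "t \<in> flexes ([:b0, b1, b2:]\<^sup>2 - smult 4 [:c0, c1, c2, c3:]) (2 * b2) e"
            then have "t \<in> {f \<in> F e. f < fst q}" using t by (simp add: F_def D_def B_def C_def)
            then show False unfolding flex_eq[symmetric] using t by simp
          qed
          show "poly ([:b0, b1, b2:]\<^sup>2 - smult 4 [:c0, c1, c2, c3:]) t > 0"
            if "fst p \<le> t" "t \<le> fst q" for t
            using Dpos[OF that] by (simp only: D_def B_def C_def)
        qed (use Z \<open>r \<in> Z\<close> lp lq lr e \<open>fst p < fst r\<close> \<open>fst r < fst q\<close> in
            \<open>simp_all only: Z_def mem_Collect_eq B_def C_def\<close>)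
      qed
      with half show ?thesis by (auto simp: of_bool_def split: if_splits)
    qed
    show "(fst p > 0 \<longleftrightarrow> fst q > 0) \<and> open_segment p q \<inter> Z = {}"
      if pq: "p \<in> S - T" "q \<in> S - T" "p \<noteq> q" "c p = c q" for p q
    proof (cases "fst p" "fst q" rule: linorder_cases)
      case less then show ?thesis using ordered pq by blast
    next
      case greater
      then show ?thesis using ordered[of q p] pq by (auto simp: open_segment_commute)
    next
      case equal
      have "\<epsilon> p = \<epsilon> q"
        using \<kappa>_less[of 1 "fst p"] \<kappa>_less[of 1 "fst q"] pq(4)
        by (auto simp: c_def \<epsilon>_def split: if_splits)
      moreover have "(2 * snd p + poly B (fst p))\<^sup>2 = (2 * snd q + poly B (fst q))\<^sup>2"
        using square pq S equal by (metis DiffD1 subsetD)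
      ultimately have "snd p = snd q"
        using equal unfolding power2_eq_iff by (auto simp: \<epsilon>_def split: if_splits)
      with equal pq show ?thesis by (simp add: prod_eq_iff)
    qed
  qed
qed

section \<open>Splitting a plane cubic into arcs\<close>

text \<open>Chords inside a class must avoid the whole curve \<open>Z\<close> and not only the
  finite set \<open>S\<close>, so that every point blocking such a chord lies off the curve.\<close>

definition arc_colourable :: "nat \<Rightarrow> nat \<Rightarrow> 'a::real_vector set \<Rightarrow> 'a set \<Rightarrow> bool" where
  "arc_colourable j n Z S \<longleftrightarrow> (\<exists>T c. T \<subseteq> S \<and> card T \<le> j \<and> (\<forall>p \<in> S - T. c p < n) \<and>
     (\<forall>p \<in> S - T. \<forall>q \<in> S - T. p \<noteq> q \<longrightarrow> c p = c q \<longrightarrow> open_segment p q \<inter> Z = {}))"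

text \<open>Colourings are pulled back along \<open>g\<close>: a point of \<open>Z\<close> on an
  open chord maps to a point of \<open>Z'\<close> on the image chord. This carries out the affine
  changes of coordinates.\<close>

lemma arc_colourable_image:
  assumes inj: "inj_on g S" and Z: "g ` Z \<subseteq> Z'"
    and seg: "\<And>p q r. r \<in> open_segment p q \<Longrightarrow> g r \<in> open_segment (g p) (g q)"
    and S: "arc_colourable j n Z' (g ` S)"
  shows "arc_colourable j n Z S"
proof -
  obtain T c where T: "T \<subseteq> g ` S" "card T \<le> j" "\<forall>p \<in> g ` S - T. c p < n"
    "\<forall>p \<in> g ` S - T. \<forall>q \<in> g ` S - T. p \<noteq> q \<longrightarrow> c p = c q \<longrightarrow>
      open_segment p q \<inter> Z' = {}"
    using S unfolding arc_colourable_def by (elim exE conjE) (rule that)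
  define T0 where "T0 = {p \<in> S. g p \<in> T}"
  have "g ` T0 = T" using T(1) by (auto simp: T0_def)
  moreover have "inj_on g T0" using inj by (rule inj_on_subset) (auto simp: T0_def)
  ultimately have "card T0 = card T" using card_image by metis
  moreover have "open_segment p q \<inter> Z = {}"
    if "p \<in> S - T0" "q \<in> S - T0" "p \<noteq> q" "c (g p) = c (g q)" for p q
  proof -
    have "g p \<in> g ` S - T" "g q \<in> g ` S - T" "g p \<noteq> g q"
      using that inj by (auto simp: T0_def inj_on_def)
    then have "open_segment (g p) (g q) \<inter> Z' = {}" using T(4) that(4) by blast
    then show ?thesis using seg Z by blast
  qed
  ultimately show ?thesis
    unfolding arc_colourable_def using T(2,3)
    by (intro exI[of _ T0] exI[of _ "\<lambda>p. c (g p)"]) (auto simp: T0_def)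
qed

text \<open>The map sending a point \<open>(X, Y)\<close> to \<open>(1 / X, Y / X)\<close> is projective and preserves segments
  on either side of the axis, which is why the monic case also separates the two half planes.\<close>

lemma arc_colourable_tangent_at_infinity:
  fixes b0 b1 b2 c0 c1 c2 c3 :: real and S :: "(real \<times> real) set"
  defines "f \<equiv> \<lambda>x y. x * y\<^sup>2 + poly [:b0, b1, b2:] x * y + poly [:c0, c1, c2, c3:] x"
  assumes S: "finite S" "\<And>p. p \<in> S \<Longrightarrow> f (fst p) (snd p) = 0"
    and line: "\<And>l. degree l \<le> 1 \<Longrightarrow> finite {x. f x (poly l x) = 0}"
    and vertical: "\<And>x. finite {y. f x y = 0}"
  shows "arc_colourable 13 15 {p. f (fst p) (snd p) = 0} S"
proof -
  \<comment> \<open>In the coordinates \<open>t = 1 / x\<close> and \<open>y / x\<close> the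
    coefficient lists of \<open>B\<close> and \<open>C\<close> are reversed, and the equation
    becomes monic in the second coordinate.\<close>
  define h where "h t y = y\<^sup>2 + poly [:b2, b1, b0:] t * y + poly [:c3, c2, c1, c0:] t" for t y :: real
  have fh: "f x y = x ^ 3 * h (1 / x) (y / x)" if "x \<noteq> 0" for x y
    using that by (simp add: f_def h_def field_simps power2_eq_square power3_eq_cube)
  define \<sigma> where "\<sigma> p = (1 / fst p, snd p / fst p)" for p :: "real \<times> real"
  define S0 where "S0 = {p \<in> S. fst p = 0}"
  have inj: "inj_on \<sigma> (S - S0)"
    using S(1) by (intro inj_onI) (auto simp: \<sigma>_def S0_def prod_eq_iff)
  \<comment> \<open>The line \<open>x = 0\<close> is the one sent to infinity. On it the square term
    vanishes, and what remains is a nontrivial affine equation in \<open>y\<close>.\<close>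
  have "card S0 \<le> 1"
  proof -
    have "b0 \<noteq> 0 \<or> c0 \<noteq> 0"
    proof (rule ccontr)
      assume "\<not> ?thesis"
      then have "{y. f 0 y = 0} = UNIV" by (auto simp: f_def)
      with vertical[of 0] show False by (simp add: infinite_UNIV_char_0)
    qed
    moreover have "b0 * snd p + c0 = 0" if "p \<in> S0" for p
      using S(2)[of p] that by (simp add: S0_def f_def)
    ultimately have "p = q" if "p \<in> S0" "q \<in> S0" for p q
    proof -
      have eq: "b0 * snd p + c0 = 0" "b0 * snd q + c0 = 0" using that \<open>\<And>p. p \<in> S0 \<Longrightarrow> _\<close> by auto
      then have "b0 * (snd p - snd q) = 0" by algebra
      moreover have "b0 \<noteq> 0" using eq \<open>b0 \<noteq> 0 \<or> c0 \<noteq> 0\<close> by auto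
      ultimately show ?thesis using that by (simp add: S0_def prod_eq_iff)
    qed
    then show ?thesis using S(1) by (auto simp: S0_def intro!: card_le_Suc0_iff_eq[THEN iffD2])
  qed
  have hline: "finite {t. h t (poly l t) = 0}"
    if l: "degree l \<le> 1" for l
  proof -
    have l_eq: "l = [:coeff l 0, coeff l 1:]"
      using l by (intro poly_eqI) (auto simp: coeff_pCons coeff_eq_0 split: nat.split)
    \<comment> \<open>The map takes lines to lines; a graph goes to the graph with intercept and
      slope exchanged.\<close>
    let ?l = "[:coeff l 1, coeff l 0:]"
    have lt: "poly l t = poly ?l (1 / t) / (1 / t)" if "t \<noteq> 0" for t
      using that by (subst l_eq) (simp add: field_simps)
    have "{t. h t (poly l t) = 0} \<subseteq> insert 0 ((\<lambda>x. 1 / x) ` {x. f x (poly ?l x) = 0})"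
    proof
      fix t assume t: "t \<in> {t. h t (poly l t) = 0}"
      have "t = 1 / (1 / t) \<and> f (1 / t) (poly ?l (1 / t)) = 0" if "t \<noteq> 0"
      proof -
        have "f (1 / t) (poly ?l (1 / t)) = (1 / t) ^ 3 * h (1 / (1 / t)) (poly ?l (1 / t) / (1 / t))"
          by (rule fh) (use that in simp)
        also have "\<dots> = (1 / t) ^ 3 * h t (poly l t)" unfolding lt[OF that] by simp
        finally show ?thesis using t by simp
      qed
      then show "t \<in> insert 0 ((\<lambda>x. 1 / x) ` {x. f x (poly ?l x) = 0})" by blast
    qed
    moreover have "finite {x. f x (poly ?l x) = 0}" by (rule line) simp
    ultimately show ?thesis by (meson finite.insertI finite_imageI finite_subset)
  qed
  have "\<sigma> ` (S - S0) \<subseteq> {p. h (fst p) (snd p) = 0}"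
  proof (intro image_subsetI CollectI)
    fix p assume "p \<in> S - S0"
    then have "fst p \<noteq> 0" "fst p ^ 3 * h (1 / fst p) (snd p / fst p) = 0"
      using S(2)[of p] fh[of "fst p" "snd p"] by (auto simp: S0_def)
    then show "h (fst (\<sigma> p)) (snd (\<sigma> p)) = 0" by (simp add: \<sigma>_def)
  qed
  note monic = arc_colouring_monic[of "\<sigma> ` (S - S0)" b2 b1 b0 c3 c2 c1 c0, folded h_def,
      OF finite_imageI[OF finite_Diff[OF S(1)]] this hline]
  obtain T' c' where T': "T' \<subseteq> \<sigma> ` (S - S0)" "card T' \<le> 4"
    "\<And>p. p \<in> \<sigma> ` (S - S0) - T' \<Longrightarrow> c' p < (15 :: nat)"
    "\<And>p q. p \<in> \<sigma> ` (S - S0) - T' \<Longrightarrow> q \<in> \<sigma> ` (S - S0) - T' \<Longrightarrow> p \<noteq> q \<Longrightarrow> c' p = c' q \<Longrightarrow>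
      (fst p > 0 \<longleftrightarrow> fst q > 0) \<and> open_segment p q \<inter> {p. h (fst p) (snd p) = 0} = {}"
    by (rule monic) (assumption | rule that)+
  define T where "T = S0 \<union> {p \<in> S - S0. \<sigma> p \<in> T'}"
  have "card {p \<in> S - S0. \<sigma> p \<in> T'} \<le> card T'"
    using T'(1) S(1) by (intro card_inj_on_le[of \<sigma>] inj_on_subset[OF inj]) (auto intro: finite_subset)
  \<comment> \<open>In fact at most \<open>1 + 4 = 5\<close>.\<close>
  then have "card T \<le> 13"
    using \<open>card S0 \<le> 1\<close> T'(2) card_Un_le[of S0 "{p \<in> S - S0. \<sigma> p \<in> T'}"] by (simp add: T_def)
  moreover have "f (fst r) (snd r) \<noteq> 0"
    if pq: "p \<in> S - T" "q \<in> S - T" "p \<noteq> q" "c' (\<sigma> p) = c' (\<sigma> q)" and r: "r \<in> open_segment p q"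
    for p q r
  proof
    assume fr: "f (fst r) (snd r) = 0"
    have nz: "fst p \<noteq> 0" "fst q \<noteq> 0" using pq by (auto simp: T_def S0_def)
    have \<sigma>: "\<sigma> p \<noteq> \<sigma> q" using inj pq by (auto simp: T_def inj_on_def)
    have "(fst (\<sigma> p) > 0 \<longleftrightarrow> fst (\<sigma> q) > 0)"
      and no: "open_segment (\<sigma> p) (\<sigma> q) \<inter> {p. h (fst p) (snd p) = 0} = {}"
      using T'(4)[of "\<sigma> p" "\<sigma> q"] pq \<sigma> by (auto simp: T_def)
    then have sgn: "fst p > 0 \<longleftrightarrow> fst q > 0" by (simp add: \<sigma>_def)
    obtain u where u: "0 < u" "u < 1" "r = (1 - u) *\<^sub>R p + u *\<^sub>R q"
      using r by (auto simp: in_segment)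
    have fst_r: "fst r = (1 - u) * fst p + u * fst q" and snd_r: "snd r = (1 - u) * snd p + u * snd q"
      by (simp_all add: u(3))
    \<comment> \<open>The projective map rescales the barycentric weights \<open>1 - u\<close> and
      \<open>u\<close> by \<open>fst p / fst r\<close> and \<open>fst q / fst r\<close>. Both
      factors are positive exactly because \<open>p\<close> and \<open>q\<close> lie on the same
      side of the axis.\<close>
    define v where "v = u * fst q / fst r"
    have r0: "fst r \<noteq> 0" and v: "0 < v" "0 < (1 - u) * fst p / fst r"
    proof -
      have "fst r > 0 \<and> fst p > 0 \<and> fst q > 0 \<or> fst r < 0 \<and> fst p < 0 \<and> fst q < 0"
        using sgn nz u(1,2) unfolding fst_r
        by (cases "fst p > 0") (auto intro!: add_pos_pos add_neg_neg mult_pos_pos mult_pos_neg)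
      then show "fst r \<noteq> 0" "0 < v" "0 < (1 - u) * fst p / fst r"
        using u(1,2) by (auto simp: v_def zero_less_divide_iff mult_less_0_iff zero_less_mult_iff)
    qed
    have "fst r - u * fst q = (1 - u) * fst p" by (simp add: fst_r)
    then have v1: "1 - v = (1 - u) * fst p / fst r"
      unfolding v_def using r0 by (metis diff_divide_distrib divide_self)
    have "(1 - v) * (a / fst p) + v * (b / fst q) = ((1 - u) * a + u * b) / fst r" for a b
      using nz r0 unfolding v1 unfolding v_def by (simp add: add_divide_distrib)
    from this[of 1 1] this[of "snd p" "snd q"] have "\<sigma> r = (1 - v) *\<^sub>R \<sigma> p + v *\<^sub>R \<sigma> q"
      by (simp add: \<sigma>_def prod_eq_iff snd_r)
    moreover have "v < 1" using v(2) unfolding v1[symmetric] by simp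
    ultimately have "\<sigma> r \<in> open_segment (\<sigma> p) (\<sigma> q)"
      using v(1) \<sigma> unfolding in_segment by blast
    moreover have "h (fst (\<sigma> r)) (snd (\<sigma> r)) = 0" using fr r0 by (simp add: fh \<sigma>_def)
    ultimately show False using no by blast
  qed
  moreover have "c' (\<sigma> p) < 15" if "p \<in> S - T" for p
    using T'(3)[of "\<sigma> p"] that by (auto simp: T_def)
  moreover have "T \<subseteq> S" by (auto simp: T_def S0_def)
  ultimately have "T \<subseteq> S \<and> card T \<le> 13 \<and> (\<forall>p \<in> S - T. c' (\<sigma> p) < 15) \<and>
      (\<forall>p \<in> S - T. \<forall>q \<in> S - T. p \<noteq> q \<longrightarrow> c' (\<sigma> p) = c' (\<sigma> q) \<longrightarrow>
        open_segment p q \<inter> {p. f (fst p) (snd p) = 0} = {})"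
    by blast
  then show ?thesis
    unfolding arc_colourable_def by (intro exI[of _ T] exI[of _ "\<lambda>p. c' (\<sigma> p)"])
qed

lemma arc_colourable_monic:
  fixes b0 b1 b2 c0 c1 c2 c3 :: real and S :: "(real \<times> real) set"
  defines "f \<equiv> \<lambda>x y. y\<^sup>2 + poly [:b0, b1, b2:] x * y + poly [:c0, c1, c2, c3:] x"
  assumes S: "finite S" "\<And>p. p \<in> S \<Longrightarrow> f (fst p) (snd p) = 0"
    and line: "\<And>l. degree l \<le> 1 \<Longrightarrow> finite {x. f x (poly l x) = 0}"
  shows "arc_colourable 13 15 {p. f (fst p) (snd p) = 0} S"
proof -
  let ?Z = "{p. (snd p)\<^sup>2 + poly [:b0, b1, b2:] (fst p) * snd p + poly [:c0, c1, c2, c3:] (fst p) = 0}"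
  have Z: "{p. f (fst p) (snd p) = 0} = ?Z" by (simp add: f_def)
  have "S \<subseteq> ?Z" using S(2) Z by blast
  obtain T c where T: "T \<subseteq> S" "card T \<le> 4" "\<And>p. p \<in> S - T \<Longrightarrow> c p < (15 :: nat)"
    "\<And>p q. p \<in> S - T \<Longrightarrow> q \<in> S - T \<Longrightarrow> p \<noteq> q \<Longrightarrow> c p = c q \<Longrightarrow>
      (fst p > 0 \<longleftrightarrow> fst q > 0) \<and> open_segment p q \<inter> ?Z = {}"
    by (rule arc_colouring_monic[OF S(1) \<open>S \<subseteq> ?Z\<close> line[unfolded f_def]]) (assumption | rule that)+
  have "open_segment p q \<inter> {p. f (fst p) (snd p) = 0} = {}"
    if "p \<in> S - T" "q \<in> S - T" "p \<noteq> q" "c p = c q" for p q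
    using T(4)[OF that] by (simp only: Z)
  moreover have "card T \<le> 13" using T(2) by simp
  ultimately show ?thesis
    unfolding arc_colourable_def using T(1,3) by (intro exI[of _ T] exI[of _ c] conjI ballI impI) 
qed

text \<open>The curve is the graph of \<open>-C / B\<close>. It is cut at the poles and at the zeros
  of the second derivative; \<open>W\<close> and \<open>M\<close> are the numerators of the first
  two derivatives of \<open>C / B\<close>. At most nine cuts leave at most ten arcs, and there are
  no exceptional points.\<close>

lemma arc_colourable_graph:
  fixes B C :: "real poly" and S :: "(real \<times> real) set"
  defines "f \<equiv> \<lambda>x y. poly B x * y + poly C x"
  assumes deg: "degree B \<le> 2" "degree C \<le> 3"
    and S: "\<And>p. p \<in> S \<Longrightarrow> f (fst p) (snd p) = 0"
    and line: "\<And>l. degree l \<le> 1 \<Longrightarrow> finite {x. f x (poly l x) = 0}"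
    and vertical: "\<And>x. finite {y. f x y = 0}"
  shows "arc_colourable 13 15 {p. f (fst p) (snd p) = 0} S"
proof (cases "S = {}")
  case True
  then show ?thesis by (auto simp: arc_colourable_def)
next
  case False
  have B_nz: "poly B (fst p) \<noteq> 0" if "f (fst p) (snd p) = 0" for p
  proof
    assume "poly B (fst p) = 0"
    then have "{y. f (fst p) y = 0} = UNIV" using that by (auto simp: f_def)
    with vertical[of "fst p"] show False by (simp add: infinite_UNIV_char_0)
  qed
  with False S have "B \<noteq> 0" by fastforce
  define W where "W = pderiv C * B - C * pderiv B"
  define M where "M = pderiv W * B - smult 2 (W * pderiv B)"
  have deriv: "((\<lambda>x. poly C x / poly B x) has_real_derivative poly W x / (poly B x)\<^sup>2) (at x)"
    "((\<lambda>x. poly W x / (poly B x)\<^sup>2) has_real_derivative poly M x / (poly B x) ^ 3) (at x)"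
    if "poly B x \<noteq> 0" for x
  proof -
    show "((\<lambda>x. poly C x / poly B x) has_real_derivative poly W x / (poly B x)\<^sup>2) (at x)"
      using DERIV_divide[OF poly_DERIV poly_DERIV that, of C] by (simp add: W_def power2_eq_square)
    have "((\<lambda>x. (poly B x)\<^sup>2) has_real_derivative 2 * poly B x * poly (pderiv B) x) (at x)"
      using DERIV_power[OF poly_DERIV[of B x], of 2] by (simp add: mult_ac)
    from DERIV_divide[OF poly_DERIV this, of W] that
    have "((\<lambda>x. poly W x / (poly B x)\<^sup>2) has_real_derivative
      (poly (pderiv W) x * (poly B x)\<^sup>2 - poly W x * (2 * poly B x * poly (pderiv B) x))
        / ((poly B x)\<^sup>2 * (poly B x)\<^sup>2)) (at x)" by simp
    also have "(poly (pderiv W) x * (poly B x)\<^sup>2 - poly W x * (2 * poly B x * poly (pderiv B) x))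
        / ((poly B x)\<^sup>2 * (poly B x)\<^sup>2) = poly M x / (poly B x) ^ 3"
      using that by (simp add: M_def field_simps power2_eq_square power3_eq_cube)
    finally show "((\<lambda>x. poly W x / (poly B x)\<^sup>2) has_real_derivative poly M x / (poly B x) ^ 3) (at x)" .
  qed
  have "M \<noteq> 0"
  proof
    assume "M = 0"
    \<comment> \<open>If the second derivative vanished identically, \<open>C / B\<close> would be
      affine to the right of all poles, and the curve would contain a ray.\<close>
    have "finite {x. poly B x = 0}" using \<open>B \<noteq> 0\<close> by (rule poly_roots_finite)
    then obtain R where R: "\<And>x. x \<in> {x. poly B x = 0} \<Longrightarrow> x \<le> R"
      by (meson bdd_above_finite bdd_above_def)
    then have B: "poly B x \<noteq> 0" if "x > R" for x using that by force
    have "\<exists>k. \<forall>x \<in> {R<..}. poly W x / (poly B x)\<^sup>2 = k"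
      by (rule has_field_derivative_zero_constant) (use deriv(2) B \<open>M = 0\<close> in \<open>auto intro: DERIV_subset\<close>)
    then obtain k where k: "\<And>x. x > R \<Longrightarrow> poly W x / (poly B x)\<^sup>2 = k" by auto
    have "\<exists>d. \<forall>x \<in> {R<..}. poly C x / poly B x - k * x = d"
    proof (rule has_field_derivative_zero_constant)
      fix x assume "x \<in> {R<..}"
      then have "((\<lambda>x. poly C x / poly B x - k * x) has_real_derivative k - k * 1) (at x)"
        using deriv(1)[of x] B[of x] k[of x] by (intro DERIV_diff DERIV_cmult DERIV_ident) auto
      then show "((\<lambda>x. poly C x / poly B x - k * x) has_real_derivative 0) (at x within {R<..})"
        by (auto intro: DERIV_subset)
    qed simp
    then obtain d where d: "\<And>x. x > R \<Longrightarrow> poly C x / poly B x - k * x = d" by auto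
    have "f x (poly [:-d, -k:] x) = 0" if "x > R" for x
      using d[OF that] B[OF that] by (simp add: f_def field_simps)
    then have "{R<..} \<subseteq> {x. f x (poly [:-d, -k:] x) = 0}" by auto
    moreover have "finite {x. f x (poly [:-d, -k:] x) = 0}" by (rule line) simp
    ultimately show False using infinite_Ioi finite_subset by blast
  qed
  define R where "R = {x. poly (B * M) x = 0}"
  have "B * M \<noteq> 0" using \<open>B \<noteq> 0\<close> \<open>M \<noteq> 0\<close> by simp
  have degW: "degree W \<le> 5"
    unfolding W_def using deg
    by (intro degree_diff_le order.trans[OF degree_mult_le]) (simp_all add: degree_pderiv)
  then have "degree M \<le> 7"
    unfolding M_def using deg
    by (intro degree_diff_le order.trans[OF degree_mult_le] order.trans[OF degree_smult_le])
      (simp_all add: degree_pderiv)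
  then have "degree (B * M) \<le> 9"
    using deg by (intro order.trans[OF degree_mult_le]) simp
  then have R: "finite R" "card R \<le> 9"
    using \<open>B * M \<noteq> 0\<close> card_poly_roots_bound[of "B * M"] by (auto simp: R_def poly_roots_finite)
  define c where "c p = card {x \<in> R. x < fst p}" for p :: "real \<times> real"
  have c: "c p < 15" for p
    using card_mono[OF R(1), of "{x \<in> R. x < fst p}"] R(2) by (auto simp: c_def)
  have ordered: "r \<notin> {p. f (fst p) (snd p) = 0}"
    if p: "p \<in> S" and q: "q \<in> S" and pq: "fst p < fst q" and cpq: "c p = c q"
      and r: "r \<in> open_segment p q" for p q r
  proof
    assume "r \<in> {p. f (fst p) (snd p) = 0}"
    then have fr: "f (fst r) (snd r) = 0" by simp
    have "{x \<in> R. x < fst p} = {x \<in> R. x < fst q}"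
      using cpq pq R(1) by (intro card_subset_eq) (auto simp: c_def)
    then have "x \<notin> R" if "fst p \<le> x" "x < fst q" for x
      using that by (metis (mono_tags, lifting) mem_Collect_eq not_less)
    then have no_root: "poly B x \<noteq> 0" "poly M x \<noteq> 0" if "fst p \<le> x" "x < fst q" for x
      using that by (auto simp: R_def)
    \<comment> \<open>Equal counts say nothing about the abscissa of \<open>q\<close> itself. There
      \<open>B\<close> is nonzero because \<open>q\<close> is on the curve and no vertical line
      is.\<close>
    have Bx: "poly B x \<noteq> 0" if "fst p \<le> x" "x \<le> fst q" for x
      using no_root(1)[of x] B_nz[OF S[OF q]] that by (cases "x = fst q") auto
    obtain u where u: "0 < u" "u < 1" "r = (1 - u) *\<^sub>R p + u *\<^sub>R q"
      using r by (auto simp: in_segment)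
    define m where "m = (snd q - snd p) / (fst q - fst p)"
    have m: "m * (fst q - fst p) = snd q - snd p" using pq by (simp add: m_def)
    have fst_r: "fst r = fst p + u * (fst q - fst p)" and snd_r: "snd r = snd p + u * (snd q - snd p)"
      by (simp_all add: u(3) algebra_simps)
    have "0 < u * (fst q - fst p)" using u pq by simp
    then have pr: "fst p < fst r" by (simp add: fst_r)
    have "u * (fst q - fst p) < 1 * (fst q - fst p)"
      using u(2) pq by (intro mult_strict_right_mono) auto
    then have rq: "fst r < fst q" by (simp add: fst_r)
    \<comment> \<open>Chord minus graph: the plus sign stems from the graph being that of
      \<open>-C / B\<close>.\<close>
    let ?g = "\<lambda>x. poly C x / poly B x + (snd p + m * (x - fst p))"
    obtain x where x: "fst p < x" "x < fst q" "poly M x / (poly B x) ^ 3 = 0"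
    proof (rule second_derivative_zero[of "fst p" "fst r" "fst q" ?g
          "\<lambda>x. poly W x / (poly B x)\<^sup>2 + m" "\<lambda>x. poly M x / (poly B x) ^ 3"])
      have zero: "poly C (fst v) / poly B (fst v) + snd v = 0" if "f (fst v) (snd v) = 0" for v
        using that B_nz[OF that] by (simp add: f_def field_simps)
      show "?g (fst p) = 0" using zero[OF S[OF p]] by simp
      show "?g (fst q) = 0" using zero[OF S[OF q]] m by simp
      have "m * (fst r - fst p) = u * (m * (fst q - fst p))" by (simp add: fst_r)
      then show "?g (fst r) = 0" using zero[OF fr] unfolding m by (simp add: snd_r)
      fix x assume "fst p \<le> x" "x \<le> fst q"
      then have "poly B x \<noteq> 0" by (rule Bx)
      then show "((\<lambda>x. poly W x / (poly B x)\<^sup>2 + m) has_real_derivative poly M x / (poly B x) ^ 3) (at x)"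
        using DERIV_add[OF deriv(2) DERIV_const] by simp
      have "((\<lambda>x. snd p + m * (x - fst p)) has_real_derivative m) (at x)"
        by (auto intro!: derivative_eq_intros)
      then show "(?g has_real_derivative poly W x / (poly B x)\<^sup>2 + m) (at x)"
        using DERIV_add[OF deriv(1)[OF \<open>poly B x \<noteq> 0\<close>]] by blast
    qed (use pr rq in auto)
    then show False using no_root[of x] by auto
  qed
  have "open_segment p q \<inter> {p. f (fst p) (snd p) = 0} = {}"
    if pq: "p \<in> S" "q \<in> S" "p \<noteq> q" "c p = c q" for p q
  proof (cases "fst p" "fst q" rule: linorder_cases)
    case less
    then show ?thesis using ordered[OF pq(1,2) _ pq(4)] by blast
  next
    case greater
    then show ?thesis
      using ordered[OF pq(2,1) _ pq(4)[symmetric]] by (auto simp: open_segment_commute[of p q])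
  next
    case equal
    have "poly B (fst p) * (snd p - snd q) = 0"
      using S[OF pq(1)] S[OF pq(2)] equal unfolding f_def by algebra
    then have "snd p = snd q" using B_nz[OF S[OF pq(1)]] by simp
    with equal pq show ?thesis by (simp add: prod_eq_iff)
  qed
  with c show ?thesis
    unfolding arc_colourable_def by (intro exI[of _ "{}"] exI[of _ c]) simp
qed

text \<open>The curve passes through the point at infinity of the second axis, and
  \<open>a0 + a1 x\<close> describes its tangent there: the affine line \<open>x = -a0 / a1\<close>,
  the line at infinity if only \<open>a1 = 0\<close>, or none if both vanish and the point is
  singular. In the first case a translation moves the tangent to the axis.\<close>

lemma arc_colourable_quadratic_in_ordinate:
  fixes a0 a1 b0 b1 b2 c0 c1 c2 c3 :: real and S :: "(real \<times> real) set"
  defines "f \<equiv> \<lambda>x y. poly [:a0, a1:] x * y\<^sup>2 + poly [:b0, b1, b2:] x * y + poly [:c0, c1, c2, c3:] x"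
  assumes S: "finite S" "\<And>p. p \<in> S \<Longrightarrow> f (fst p) (snd p) = 0"
    and line: "\<And>l. degree l \<le> 1 \<Longrightarrow> finite {x. f x (poly l x) = 0}"
    and vertical: "\<And>x. finite {y. f x y = 0}"
  shows "arc_colourable 13 15 {p. f (fst p) (snd p) = 0} S"
proof -
  consider (tangent) "a1 \<noteq> 0" | (monic) "a1 = 0" "a0 \<noteq> 0" | (graph) "a1 = 0" "a0 = 0" by blast
  then show ?thesis
  proof cases
    case tangent
    define x0 where "x0 = - a0 / a1"
    have a0: "a0 = - a1 * x0" using tangent by (simp add: x0_def)
    define \<beta>0 \<beta>1 \<beta>2 where "\<beta>0 = b0 / a1" and "\<beta>1 = b1 / a1" and "\<beta>2 = b2 / a1"
    define \<gamma>0 \<gamma>1 \<gamma>2 \<gamma>3 where "\<gamma>0 = c0 / a1" and "\<gamma>1 = c1 / a1"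
      and "\<gamma>2 = c2 / a1" and "\<gamma>3 = c3 / a1"
    have scaled: "b0 = a1 * \<beta>0" "b1 = a1 * \<beta>1" "b2 = a1 * \<beta>2"
      "c0 = a1 * \<gamma>0" "c1 = a1 * \<gamma>1" "c2 = a1 * \<gamma>2" "c3 = a1 * \<gamma>3"
      using tangent by (simp_all add: \<beta>0_def \<beta>1_def \<beta>2_def \<gamma>0_def \<gamma>1_def \<gamma>2_def \<gamma>3_def)
    let ?h = "\<lambda>x y. x * y\<^sup>2
      + poly [:\<beta>0 + \<beta>1 * x0 + \<beta>2 * x0\<^sup>2, \<beta>1 + 2 * \<beta>2 * x0, \<beta>2:] x * y
      + poly [:\<gamma>0 + \<gamma>1 * x0 + \<gamma>2 * x0\<^sup>2 + \<gamma>3 * x0 ^ 3,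
          \<gamma>1 + 2 * \<gamma>2 * x0 + 3 * \<gamma>3 * x0\<^sup>2, \<gamma>2 + 3 * \<gamma>3 * x0, \<gamma>3:] x"
    let ?g = "\<lambda>p :: real \<times> real. (fst p - x0, snd p)"
    have f_h: "f x y = a1 * ?h (x - x0) y" for x y
      unfolding f_def a0 scaled
      by (simp add: algebra_simps power2_eq_square power3_eq_cube)
    have h_f: "?h x y = 0 \<longleftrightarrow> f (x + x0) y = 0" for x y
      using f_h[of "x + x0" y] tangent by simp
    have "arc_colourable 13 15 {p. ?h (fst p) (snd p) = 0} (?g ` S)"
    proof (rule arc_colourable_tangent_at_infinity)
      show "finite (?g ` S)" using S(1) by simp
      show "?h (fst p) (snd p) = 0" if "p \<in> ?g ` S" for p
        using that S(2) unfolding h_f by auto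
      show "finite {y. ?h x y = 0}" for x unfolding h_f by (rule vertical)
      show "finite {x. ?h x (poly l x) = 0}" if "degree l \<le> 1" for l
      proof -
        have "{x. ?h x (poly l x) = 0} = (\<lambda>x. x - x0) ` {x. f x (poly (pcompose l [:-x0, 1:]) x) = 0}"
          unfolding h_f by (auto simp: poly_pcompose image_iff intro!: exI[of _ "_ + x0"])
        moreover have "degree (pcompose l [:-x0, 1:]) \<le> 1" using that by (simp add: degree_pcompose)
        ultimately show ?thesis using line finite_imageI by metis
      qed
    qed
    then show ?thesis
    proof (rule arc_colourable_image[rotated -1])
      show "inj_on ?g S" by (auto simp: inj_on_def prod_eq_iff)
      show "?g ` {p. f (fst p) (snd p) = 0} \<subseteq> {p. ?h (fst p) (snd p) = 0}"
        unfolding h_f by auto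
      show "?g r \<in> open_segment (?g p) (?g q)" if "r \<in> open_segment p q" for p q r
      proof -
        have "?g v = (- x0, 0) + v" for v by (simp add: prod_eq_iff)
        then show ?thesis using that by (simp only: open_segment_translation_eq)
      qed
    qed
  next
    case monic
    let ?h = "\<lambda>x y. y\<^sup>2 + poly [:b0 / a0, b1 / a0, b2 / a0:] x * y
      + poly [:c0 / a0, c1 / a0, c2 / a0, c3 / a0:] x"
    have "f x y = a0 * ?h x y" for x y
      using monic by (simp add: f_def field_simps)
    then have h_f: "?h x y = 0 \<longleftrightarrow> f x y = 0" for x y using monic by simp
    have "arc_colourable 13 15 {p. ?h (fst p) (snd p) = 0} S"
      by (rule arc_colourable_monic) (use S line in \<open>simp_all only: h_f\<close>)
    then show ?thesis unfolding h_f .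
  next
    case graph
    have f: "f x y = poly [:b0, b1, b2:] x * y + poly [:c0, c1, c2, c3:] x" for x y
      by (simp add: f_def graph)
    show ?thesis
      unfolding f by (rule arc_colourable_graph) (use S line vertical in \<open>simp_all add: f[symmetric] del: poly_pCons\<close>)
  qed
qed

text \<open>\<open>m\<close> is a Cauchy root bound: at \<open>m\<close> and \<open>-m\<close> the
  leading term dominates, so the signs differ.\<close>

lemma cubic_real_root:
  fixes k0 k1 k2 k3 :: real
  assumes "k3 \<noteq> 0"
  obtains x where "poly [:k0, k1, k2, k3:] x = 0"
proof -
  define m where "m = 1 + (\<bar>k0\<bar> + \<bar>k1\<bar> + \<bar>k2\<bar>) / \<bar>k3\<bar>"
  have m: "m \<ge> 1" by (simp add: m_def)
  have "\<bar>k3\<bar> * m = \<bar>k3\<bar> + (\<bar>k0\<bar> + \<bar>k1\<bar> + \<bar>k2\<bar>)"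
    unfolding m_def using assms by (subst distrib_left) simp
  then have k3: "\<bar>k0\<bar> + \<bar>k1\<bar> + \<bar>k2\<bar> < \<bar>k3\<bar> * m" using assms by simp
  have dom: "\<bar>k0 + k1 * x + k2 * x\<^sup>2\<bar> < \<bar>k3\<bar> * m ^ 3" if "\<bar>x\<bar> = m" for x
  proof -
    have m2: "1 \<le> m\<^sup>2" "m \<le> m\<^sup>2" using m by (simp_all add: power2_eq_square mult_ge1_I)
    have "\<bar>k0 + k1 * x + k2 * x\<^sup>2\<bar> \<le> \<bar>k0\<bar> + \<bar>k1\<bar> * m + \<bar>k2\<bar> * m\<^sup>2"
      using that by (auto simp: abs_mult power_abs[symmetric] intro!: order.trans[OF abs_triangle_ineq] add_mono)
    also have "\<dots> \<le> \<bar>k0\<bar> * m\<^sup>2 + \<bar>k1\<bar> * m\<^sup>2 + \<bar>k2\<bar> * m\<^sup>2"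
      using m2 by (intro add_mono mult_left_mono mult_right_mono) (auto simp: mult_le_cancel_left1)
    also have "\<dots> = (\<bar>k0\<bar> + \<bar>k1\<bar> + \<bar>k2\<bar>) * m\<^sup>2" by (simp add: algebra_simps)
    also have "\<dots> < (\<bar>k3\<bar> * m) * m\<^sup>2" using k3 m by (intro mult_strict_right_mono) auto
    finally show ?thesis by (simp add: power2_eq_square power3_eq_cube mult_ac)
  qed
  have split: "poly [:k0, k1, k2, k3:] x = (k0 + k1 * x + k2 * x\<^sup>2) + k3 * x ^ 3" for x
    by (simp add: algebra_simps power2_eq_square power3_eq_cube)
  have "poly [:k0, k1, k2, k3:] (-m) * poly [:k0, k1, k2, k3:] m < 0"
    using dom[of m] dom[of "-m"] m assms unfolding split
    by (cases "k3 > 0") (auto simp: mult_less_0_iff abs_if split: if_splits)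
  moreover have "-m < m" using m by simp
  ultimately show ?thesis using poly_IVT that by blast
qed

text \<open>A real root of the top form gives a real point at infinity. Once the second axis points in
  that direction, the equation is at most quadratic in the second coordinate.\<close>

lemma arc_colourable_cubic:
  fixes k30 k21 k12 k03 k20 k11 k02 k10 k01 k00 :: real and S :: "(real ^ 2) set"
  defines "G \<equiv> \<lambda>x y. k30 * x ^ 3 + k21 * x\<^sup>2 * y + k12 * x * y\<^sup>2 + k03 * y ^ 3
    + k20 * x\<^sup>2 + k11 * x * y + k02 * y\<^sup>2 + k10 * x + k01 * y + k00"
  assumes S: "finite S" "\<And>p. p \<in> S \<Longrightarrow> G (p $ 1) (p $ 2) = 0"
    and line: "\<And>p1 p2 d1 d2. d1 \<noteq> 0 \<or> d2 \<noteq> 0 \<Longrightarrow> finite {t. G (p1 + t * d1) (p2 + t * d2) = 0}"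
  shows "arc_colourable 13 15 {p. G (p $ 1) (p $ 2) = 0} S"
proof -
  have seg: "\<phi> r \<in> open_segment (\<phi> p) (\<phi> q)"
    if "linear \<phi>" "inj \<phi>" "r \<in> open_segment p q" for \<phi> :: "real ^ 2 \<Rightarrow> real \<times> real" and p q r
    using open_segment_linear_image[OF that(1,2), of p q] that(3) by blast
  have l_eq: "l = [:coeff l 0, coeff l 1:]" if "degree l \<le> 1" for l :: "real poly"
    using that by (intro poly_eqI) (auto simp: coeff_pCons coeff_eq_0 split: nat.split)
  show ?thesis
  proof (cases "k30 = 0")
    case True
    \<comment> \<open>The direction of the first axis is already a point at infinity of the curve,
      so swapping the coordinates suffices.\<close>
    let ?\<phi> = "\<lambda>p :: real ^ 2. (p $ 2, p $ 1)"
    have lin: "linear ?\<phi>" by (intro linearI) (simp_all add: prod_eq_iff)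
    have inj: "inj ?\<phi>" by (auto intro!: injI simp: vec_eq_iff forall_2)
    let ?f = "\<lambda>x y. poly [:k20, k21:] x * y\<^sup>2 + poly [:k10, k11, k12:] x * y + poly [:k00, k01, k02, k03:] x"
    have f: "?f x y = G y x" for x y
      by (simp add: G_def True algebra_simps power2_eq_square power3_eq_cube)
    have "arc_colourable 13 15 {p. ?f (fst p) (snd p) = 0} (?\<phi> ` S)"
    proof (rule arc_colourable_quadratic_in_ordinate)
      show "finite (?\<phi> ` S)" using S(1) by simp
      show "?f (fst p) (snd p) = 0" if "p \<in> ?\<phi> ` S" for p
        using that S(2) unfolding f by auto
      show "finite {y. ?f x y = 0}" for x
        unfolding f using line[of 1 0 0 x] by simp
      show "finite {x. ?f x (poly l x) = 0}" if "degree l \<le> 1" for l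
        unfolding f using line[of "coeff l 1" 1 "coeff l 0" 0] by (subst l_eq[OF that]) simp
    qed
    then show ?thesis
      by (rule arc_colourable_image[rotated -1])
        (use inj_on_subset[OF inj subset_UNIV] seg[OF lin inj] in \<open>auto simp: f simp del: poly_pCons\<close>)
  next
    case False
    obtain \<alpha> where \<alpha>: "poly [:k03, k12, k21, k30:] \<alpha> = 0" using cubic_real_root[OF False] by blast
    \<comment> \<open>The shear moves the direction \<open>(\<alpha>, 1)\<close>, a zero of the top
      form, to the second axis; the new coefficient of \<open>y ^ 3\<close> is the top form at
      \<open>(\<alpha>, 1)\<close>.\<close>
    let ?\<phi> = "\<lambda>p :: real ^ 2. (p $ 1 - \<alpha> * p $ 2, p $ 2)"
    have lin: "linear ?\<phi>" by (intro linearI) (simp_all add: prod_eq_iff algebra_simps)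
    have inj: "inj ?\<phi>" by (auto intro!: injI simp: vec_eq_iff forall_2)
    let ?f = "\<lambda>x y. poly [:k20 * \<alpha>\<^sup>2 + k11 * \<alpha> + k02, 3 * k30 * \<alpha>\<^sup>2 + 2 * k21 * \<alpha> + k12:] x * y\<^sup>2
      + poly [:k10 * \<alpha> + k01, 2 * k20 * \<alpha> + k11, 3 * k30 * \<alpha> + k21:] x * y
      + poly [:k00, k10, k20, k30:] x"
    have f: "?f x y = G (x + \<alpha> * y) y" for x y
    proof -
      have "G (x + \<alpha> * y) y = ?f x y + poly [:k03, k12, k21, k30:] \<alpha> * y ^ 3"
        by (simp add: G_def algebra_simps power2_eq_square power3_eq_cube)
      then show ?thesis by (simp only: \<alpha>)
    qed
    have "arc_colourable 13 15 {p. ?f (fst p) (snd p) = 0} (?\<phi> ` S)"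
    proof (rule arc_colourable_quadratic_in_ordinate)
      show "finite (?\<phi> ` S)" using S(1) by simp
      show "?f (fst p) (snd p) = 0" if "p \<in> ?\<phi> ` S" for p
        using that S(2) unfolding f by auto
      show "finite {y. ?f x y = 0}" for x
        unfolding f using line[of \<alpha> 1 x 0] by (simp add: mult.commute)
      show "finite {x. ?f x (poly l x) = 0}" if "degree l \<le> 1" for l
      proof -
        have "x + \<alpha> * poly l x = \<alpha> * coeff l 0 + x * (1 + \<alpha> * coeff l 1)"
          "poly l x = coeff l 0 + x * coeff l 1" for x
          by (subst l_eq[OF that]; simp add: algebra_simps)+
        moreover have "1 + \<alpha> * coeff l 1 \<noteq> 0 \<or> coeff l 1 \<noteq> 0" by auto
        ultimately show ?thesis
          unfolding f using line[of "1 + \<alpha> * coeff l 1" "coeff l 1" "\<alpha> * coeff l 0" "coeff l 0"] by simp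
      qed
    qed
    then show ?thesis
      by (rule arc_colourable_image[rotated -1])
        (use inj_on_subset[OF inj subset_UNIV] seg[OF lin inj] in \<open>auto simp: f simp del: poly_pCons\<close>)
  qed
qed

section \<open>Homogeneous forms in three variables\<close>

abbreviation const3 :: "real \<Rightarrow> poly3" where "const3 c \<equiv> Poly_Mapping.single 0 c"

abbreviation var3 :: "3 \<Rightarrow> poly3" where "var3 i \<equiv> Poly_Mapping.single (Poly_Mapping.single i 1) 1"

text \<open>The target ring is left open so that evaluation, restriction to a parametrized line,
  grading and reduction modulo a linear form are all instances.\<close>

definition subst3 :: "(real \<Rightarrow> 'a::comm_ring_1) \<Rightarrow> (3 \<Rightarrow> 'a) \<Rightarrow> poly3 \<Rightarrow> 'a" where
  "subst3 \<kappa> u F = (\<Sum>e \<in> Poly_Mapping.keys F. \<kappa> (Poly_Mapping.lookup F e) *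
     (\<Prod>i \<in> UNIV. u i ^ Poly_Mapping.lookup e i))"

locale real_algebra_map =
  fixes \<kappa> :: "real \<Rightarrow> 'a::comm_ring_1"
  assumes add: "\<kappa> (a + b) = \<kappa> a + \<kappa> b"
    and mult: "\<kappa> (a * b) = \<kappa> a * \<kappa> b"
    and one: "\<kappa> 1 = 1"
begin

lemma zero: "\<kappa> 0 = 0"
  using add[of 0 0] by simp

lemma subst_zero: "subst3 \<kappa> u 0 = 0"
  by (simp add: subst3_def)

lemma subst_add: "subst3 \<kappa> u (F + G) = subst3 \<kappa> u F + subst3 \<kappa> u G"
  unfolding subst3_def
  by (rule setsum_keys_plus_distrib) (simp_all add: zero add distrib_right)

lemma subst_single:
  "subst3 \<kappa> u (Poly_Mapping.single e c) = \<kappa> c * (\<Prod>i \<in> UNIV. u i ^ Poly_Mapping.lookup e i)"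
  by (simp add: subst3_def zero)

lemma subst_sum: "subst3 \<kappa> u (sum f A) = (\<Sum>x \<in> A. subst3 \<kappa> u (f x))"
  by (induction A rule: infinite_finite_induct) (simp_all add: subst_zero subst_add)

end

lemma poly_mapping_as_sum:
  "F = (\<Sum>e \<in> Poly_Mapping.keys F. Poly_Mapping.single e (Poly_Mapping.lookup F e))"
  by (rule poly_mapping_eqI)
    (simp add: lookup_sum lookup_single when_def in_keys_iff)

context real_algebra_map
begin

lemma subst_mult: "subst3 \<kappa> u (F * G) = subst3 \<kappa> u F * subst3 \<kappa> u G"
proof -
  let ?s = "\<lambda>F e. Poly_Mapping.single e (Poly_Mapping.lookup F e) :: poly3"
  have "F * G = (\<Sum>e \<in> Poly_Mapping.keys F. \<Sum>e' \<in> Poly_Mapping.keys G. ?s F e * ?s G e')"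
    by (simp only: sum_product[symmetric] poly_mapping_as_sum[symmetric])
  then have "subst3 \<kappa> u (F * G)
      = (\<Sum>e \<in> Poly_Mapping.keys F. \<Sum>e' \<in> Poly_Mapping.keys G. subst3 \<kappa> u (?s F e * ?s G e'))"
    by (simp only: subst_sum)
  also have "\<dots> = (\<Sum>e \<in> Poly_Mapping.keys F. \<Sum>e' \<in> Poly_Mapping.keys G.
      subst3 \<kappa> u (?s F e) * subst3 \<kappa> u (?s G e'))"
    by (intro sum.cong refl)
      (simp add: mult_single subst_single mult lookup_add power_add prod.distrib mult_ac)
  also have "\<dots> = subst3 \<kappa> u F * subst3 \<kappa> u G"
    by (simp only: sum_product[symmetric] subst_sum[symmetric] poly_mapping_as_sum[symmetric])
  finally show ?thesis .
qed

end

interpretation eval3: real_algebra_map "\<lambda>c :: real. c"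
  by unfold_locales auto

interpretation grade: real_algebra_map "\<lambda>c. [:const3 c:]"
  by unfold_locales (simp_all add: single_add mult_single one_pCons mult.commute)

lemma eval3_eq_subst3: "eval3 F v = subst3 (\<lambda>c. c) (($) v) F"
  by (simp add: eval3_def subst3_def)

lemma eval3_add: "eval3 (F + G) v = eval3 F v + eval3 G v"
  by (simp add: eval3_eq_subst3 eval3.subst_add)

lemma eval3_mult: "eval3 (F * G) v = eval3 F v * eval3 G v"
  by (simp add: eval3_eq_subst3 eval3.subst_mult)

lemma var3_power: "var3 i ^ k = Poly_Mapping.single (Poly_Mapping.single i k) 1"
  by (induction k) (simp_all add: mult_single flip: single_add)

lemma single_eq_prod:
  "(Poly_Mapping.single e c :: poly3) = const3 c * (\<Prod>i \<in> UNIV. var3 i ^ Poly_Mapping.lookup e i)"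
proof -
  have "e = Poly_Mapping.single 1 (Poly_Mapping.lookup e 1)
      + Poly_Mapping.single 2 (Poly_Mapping.lookup e 2) + Poly_Mapping.single 3 (Poly_Mapping.lookup e 3)"
  proof (rule poly_mapping_eqI)
    fix k :: 3
    show "Poly_Mapping.lookup e k = Poly_Mapping.lookup (Poly_Mapping.single 1 (Poly_Mapping.lookup e 1)
      + Poly_Mapping.single 2 (Poly_Mapping.lookup e 2) + Poly_Mapping.single 3 (Poly_Mapping.lookup e 3)) k"
      using exhaust_3[of k] by (auto simp: lookup_add lookup_single when_def)
  qed
  then show ?thesis
    by (simp only: UNIV_3 var3_power) (simp add: mult_single add.assoc)
qed

lemma subst3_var3: "subst3 const3 var3 F = F"
  unfolding subst3_def single_eq_prod[symmetric] using poly_mapping_as_sum[of F] by simp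

section \<open>Homogeneity through a grading\<close>

abbreviation tdeg :: "(3 \<Rightarrow>\<^sub>0 nat) \<Rightarrow> nat" where
  "tdeg e \<equiv> (\<Sum>i \<in> UNIV. Poly_Mapping.lookup e i)"

text \<open>The form \<open>F\<close> with all variables multiplied by a new indeterminate; it is a monomial in that
  indeterminate if and only if \<open>F\<close> is homogeneous.\<close>

definition graded :: "poly3 \<Rightarrow> poly3 poly" where
  "graded = subst3 (\<lambda>c. [:const3 c:]) (\<lambda>i. monom (var3 i) 1)"

lemma graded_mult: "graded (F * G) = graded F * graded G"
  by (simp add: graded_def grade.subst_mult)

lemma graded_add: "graded (F + G) = graded F + graded G"
  by (simp add: graded_def grade.subst_add)

lemma graded_single: "graded (Poly_Mapping.single e c) = monom (Poly_Mapping.single e c) (tdeg e)"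
proof -
  have power: "monom (var3 i) 1 ^ k = monom (var3 i ^ k) k" for i k
    by (induction k) (simp_all add: mult_monom one_pCons monom_0)
  have prod: "(\<Prod>i \<in> I. monom (f i) (g i)) = monom (\<Prod>i \<in> I. f i) (\<Sum>i \<in> I. g i)"
    for f :: "3 \<Rightarrow> poly3" and g :: "3 \<Rightarrow> nat" and I
    by (induction I rule: infinite_finite_induct) (simp_all add: mult_monom one_pCons monom_0)
  have "graded (Poly_Mapping.single e c)
      = [:const3 c:] * (\<Prod>i \<in> UNIV. monom (var3 i) 1 ^ Poly_Mapping.lookup e i)"
    unfolding graded_def by (rule grade.subst_single)
  also have "\<dots> = [:const3 c:] * monom (\<Prod>i \<in> UNIV. var3 i ^ Poly_Mapping.lookup e i) (tdeg e)"
    by (simp only: power prod)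
  also have "\<dots> = monom (const3 c * (\<Prod>i \<in> UNIV. var3 i ^ Poly_Mapping.lookup e i)) (tdeg e)"
    by (simp only: mult_pCons_left mult_zero_left pCons_0_0 add_0_right smult_monom)
  finally show ?thesis by (simp only: single_eq_prod[of e c, symmetric])
qed

text \<open>The coefficients of \<open>graded F\<close> are thus the homogeneous components of
  \<open>F\<close>.\<close>

lemma lookup_coeff_graded:
  "Poly_Mapping.lookup (coeff (graded F) k) e = (if tdeg e = k then Poly_Mapping.lookup F e else 0)"
proof -
  let ?m = "\<lambda>e. monom (Poly_Mapping.single e (Poly_Mapping.lookup F e)) (tdeg e)"
  have "graded F = graded (\<Sum>e \<in> Poly_Mapping.keys F. Poly_Mapping.single e (Poly_Mapping.lookup F e))"
    using poly_mapping_as_sum[of F] by simp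
  also have "\<dots> = (\<Sum>e \<in> Poly_Mapping.keys F. ?m e)"
    unfolding graded_single[symmetric] unfolding graded_def by (rule grade.subst_sum)
  finally have "Poly_Mapping.lookup (coeff (graded F) k) e
      = (\<Sum>e' \<in> Poly_Mapping.keys F. Poly_Mapping.lookup (coeff (?m e') k) e)"
    by (simp only: coeff_sum lookup_sum)
  also have "\<dots> = (\<Sum>e' \<in> Poly_Mapping.keys F.
      if e' = e then (if tdeg e = k then Poly_Mapping.lookup F e else 0) else 0)"
    by (rule sum.cong) (auto simp: lookup_single when_def)
  also have "\<dots> = (if tdeg e = k then Poly_Mapping.lookup F e else 0)"
    by (simp add: in_keys_iff)
  finally show ?thesis .
qed

lemma homogeneous3_iff_graded: "homogeneous3 d F \<longleftrightarrow> graded F = monom F d"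
proof
  assume hom: "homogeneous3 d F"
  show "graded F = monom F d"
  proof (rule poly_eqI, rule poly_mapping_eqI)
    fix k e
    show "Poly_Mapping.lookup (coeff (graded F) k) e = Poly_Mapping.lookup (coeff (monom F d) k) e"
      using hom by (cases "e \<in> Poly_Mapping.keys F") (auto simp: lookup_coeff_graded homogeneous3_def in_keys_iff)
  qed
next
  assume eq: "graded F = monom F d"
  show "homogeneous3 d F"
    unfolding homogeneous3_def
  proof
    fix e assume "e \<in> Poly_Mapping.keys F"
    then have "Poly_Mapping.lookup (coeff (monom F d) (tdeg e)) e \<noteq> 0"
      unfolding eq[symmetric] by (simp add: lookup_coeff_graded in_keys_iff)
    then show "tdeg e = d" by (auto split: if_splits)
  qed
qed

text \<open>Monomials are characterized by order at 0 equal to degree. Both are additive on products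
  and the order never exceeds the degree, so equality passes to the factors.\<close>

lemma factor_of_monom:
  fixes p q :: "'a::idom poly"
  assumes "p * q = monom c d" "c \<noteq> 0"
  obtains a i where "p = monom a i"
proof -
  have nz: "p \<noteq> 0" "q \<noteq> 0" using assms by (auto simp: monom_eq_0_iff)
  have "order 0 (monom c d) = d" using assms(2) by (rule order_0_monom)
  moreover have "degree (monom c d) = d" using assms(2) by (rule degree_monom_eq)
  ultimately have "order 0 p + order 0 q = degree p + degree q"
    using order_mult[of p q 0] degree_mult_eq[OF nz] nz assms by simp
  then have ord: "order 0 p = degree p"
    using order_degree[OF nz(1), of 0] order_degree[OF nz(2), of 0] by linarith
  have "[:- 0, 1:] ^ degree p dvd p" using order_1[of 0 p] ord by simp
  then have "monom 1 (degree p) dvd p" by (simp add: monom_altdef)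
  then obtain r where r: "p = monom 1 (degree p) * r" by (rule dvdE)
  have "monom 1 (degree p) \<noteq> (0 :: 'a poly)" "r \<noteq> 0" using r nz by (auto simp: monom_eq_0_iff)
  then have "degree (monom 1 (degree p) * r) = degree p + degree r"
    by (simp add: degree_mult_eq degree_monom_eq)
  then have "degree r = 0" unfolding r[symmetric] by simp
  then obtain a where "r = [:a:]" by (rule degree_eq_zeroE)
  moreover have "monom 1 (degree p) * [:a:] = monom a (degree p)" by (simp add: smult_monom)
  ultimately have "p = monom a (degree p)" using r by metis
  then show ?thesis by (rule that)
qed

text \<open>Since \<open>graded\<close> is multiplicative, the factors of a form become factors of a
  monomial in the grading variable.\<close>

lemma homogeneous3_factor:
  assumes "homogeneous3 d (F * G)" "F * G \<noteq> 0"
  obtains i j where "homogeneous3 i F" "homogeneous3 j G" "i + j = d"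
proof -
  have eq: "graded F * graded G = monom (F * G) d"
    using assms by (simp add: homogeneous3_iff_graded graded_mult)
  obtain a i where a: "graded F = monom a i" using factor_of_monom[OF eq assms(2)] by blast
  obtain b j where b: "graded G = monom b j"
    using factor_of_monom[OF eq[unfolded mult.commute[of "graded F"]] assms(2)] by blast
  \<comment> \<open>A monomial value of \<open>graded\<close> can only have the form itself as its
    coefficient.\<close>
  have self: "graded H = monom H k" if "graded H = monom c k" for H c k
  proof -
    have "tdeg e = k" if "Poly_Mapping.lookup H e \<noteq> 0" for e
    proof (rule ccontr)
      assume "tdeg e \<noteq> k"
      then have "Poly_Mapping.lookup (coeff (graded H) (tdeg e)) e = 0"
        unfolding \<open>graded H = _\<close> by simp
      with that show False by (simp add: lookup_coeff_graded)
    qed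
    then have "homogeneous3 k H" by (simp add: homogeneous3_def in_keys_iff)
    then show ?thesis by (simp add: homogeneous3_iff_graded)
  qed
  have "monom (F * G) (i + j) = monom (F * G) d"
    using eq self[OF a] self[OF b] by (simp add: mult_monom)
  then have "i + j = d" using assms(2) by (metis degree_monom_eq)
  then show ?thesis
    using self[OF a] self[OF b] by (intro that[of i j]) (simp_all add: homogeneous3_iff_graded)
qed

lemma homogeneous3_unique:
  assumes "homogeneous3 d F" "homogeneous3 d' F" "F \<noteq> 0"
  shows "d = d'"
proof -
  obtain e where "e \<in> Poly_Mapping.keys F" using assms(3) by (metis equals0I keys_eq_empty)
  then show ?thesis using assms by (auto simp: homogeneous3_def)
qed

section \<open>Restriction to a line and divisibility by its form\<close>

lemma dvd_power_diff:
  fixes x y :: "'a::comm_ring_1"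
  assumes "l dvd x - y" shows "l dvd x ^ n - y ^ n"
proof (induction n)
  case (Suc n)
  have "x ^ Suc n - y ^ Suc n = x * (x ^ n - y ^ n) + (x - y) * y ^ n" by (simp add: algebra_simps)
  then show ?case using Suc assms by (metis dvd_add dvd_mult dvd_mult2)
qed simp

lemma dvd_prod_diff:
  fixes f g :: "'b \<Rightarrow> 'a::comm_ring_1"
  assumes "\<And>i. l dvd f i - g i" shows "l dvd prod f I - prod g I"
proof (induction I rule: infinite_finite_induct)
  case (insert i I)
  have "prod f (insert i I) - prod g (insert i I) = f i * (prod f I - prod g I) + (f i - g i) * prod g I"
    using insert by (simp add: algebra_simps)
  then show ?case using insert.IH assms[of i] by (metis dvd_add dvd_mult dvd_mult2)
qed simp_all

lemma dvd_subst3_diff: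
  assumes "\<And>i. l dvd u i - v i" shows "l dvd subst3 \<kappa> u F - subst3 \<kappa> v F"
  unfolding subst3_def sum_subtractf[symmetric] right_diff_distrib[symmetric]
  by (intro dvd_sum dvd_mult dvd_prod_diff dvd_power_diff assms)

lemma poly_subst3:
  "poly (subst3 (\<lambda>c. [:c:]) u F) t = eval3 F (\<chi> i. poly (u i) t)"
proof -
  have "poly [:c:] t = c" for c by simp
  then show ?thesis
    by (simp only: subst3_def eval3_def poly_sum poly_mult poly_prod poly_power vec_lambda_beta)
qed

text \<open>\<open>T\<close> and \<open>Z\<close> may be any forms. The target degree
  \<open>n\<close> is fixed independently of \<open>p\<close>, which makes the operation
  additive.\<close>

definition homogenize :: "poly3 \<Rightarrow> poly3 \<Rightarrow> nat \<Rightarrow> real poly \<Rightarrow> poly3" where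
  "homogenize T Z n p = (\<Sum>i \<le> n. const3 (coeff p i) * T ^ i * Z ^ (n - i))"

lemma homogenize_zero: "homogenize T Z n 0 = 0"
  by (simp add: homogenize_def)

lemma homogenize_add: "homogenize T Z n (p + q) = homogenize T Z n p + homogenize T Z n q"
  by (simp add: homogenize_def single_add distrib_right sum.distrib)

lemma homogenize_smult: "homogenize T Z n (smult c p) = const3 c * homogenize T Z n p"
proof -
  have "const3 (c * x) = const3 c * const3 x" for x by (simp add: mult_single)
  then show ?thesis by (simp only: homogenize_def coeff_smult sum_distrib_left mult.assoc)
qed

lemma homogenize_sum: "homogenize T Z n (sum f A) = (\<Sum>x \<in> A. homogenize T Z n (f x))"
  by (induction A rule: infinite_finite_induct) (simp_all add: homogenize_zero homogenize_add)

lemma homogenize_linear_mult: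
  assumes "degree p \<le> n"
  shows "homogenize T Z (Suc n) ([:a, b:] * p) = (const3 a * Z + const3 b * T) * homogenize T Z n p"
proof -
  have 1: "homogenize T Z (Suc n) p = Z * homogenize T Z n p"
  proof -
    have "coeff p (Suc n) = 0" using assms by (simp add: coeff_eq_0)
    then have "homogenize T Z (Suc n) p = (\<Sum>i \<le> n. const3 (coeff p i) * T ^ i * Z ^ (Suc n - i))"
      by (simp add: homogenize_def)
    also have "\<dots> = (\<Sum>i \<le> n. Z * (const3 (coeff p i) * T ^ i * Z ^ (n - i)))"
      by (rule sum.cong) (simp_all add: Suc_diff_le mult_ac)
    finally show ?thesis by (simp only: homogenize_def sum_distrib_left)
  qed
  have 2: "homogenize T Z (Suc n) (pCons 0 p) = T * homogenize T Z n p"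
    unfolding homogenize_def sum.atMost_Suc_shift sum_distrib_left
    by (simp add: mult_ac)
  have "[:a, b:] * p = smult a p + smult b (pCons 0 p)" by simp
  then show ?thesis
    by (simp only: homogenize_add homogenize_smult 1 2) (simp only: distrib_right mult.assoc)
qed

lemma homogenize_linear_power_mult:
  assumes "degree p \<le> n"
  shows "homogenize T Z (n + k) ([:a, b:] ^ k * p) = (const3 a * Z + const3 b * T) ^ k * homogenize T Z n p"
    and "degree ([:a, b:] ^ k * p) \<le> n + k"
proof (induction k)
  case (Suc k)
  { case 1
    have "[:a, b:] ^ Suc k * p = [:a, b:] * ([:a, b:] ^ k * p)" by (simp only: power_Suc mult.assoc)
    then show ?case
      using homogenize_linear_mult[OF Suc(2), of T Z a b] Suc(1)
      by (simp only: add_Suc_right power_Suc mult.assoc) }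
  { case 2
    have "degree [:a, b:] \<le> 1" by simp
    then show ?case
      using Suc(2) degree_mult_le[of "[:a, b:]" "[:a, b:] ^ k * p"]
      by (simp only: power_Suc mult.assoc) }
qed (use assms in simp_all)

lemma prod_UNIV_3: "prod f (UNIV :: 3 set) = f 1 * f 2 * f 3"
  unfolding UNIV_3 by (simp add: mult.assoc)

text \<open>Each monomial of \<open>F\<close> restricts to a product of exactly \<open>d\<close>
  factors \<open>a + b t\<close>, and homogenizing to degree \<open>d\<close> replaces each of them
  by \<open>a Z + b T\<close>, also when \<open>b = 0\<close>.\<close>

lemma homogenize_subst3:
  assumes hom: "homogeneous3 d F"
  shows "homogenize T Z d (subst3 (\<lambda>c. [:c:]) (\<lambda>i. [:a i, b i:]) F)
    = subst3 const3 (\<lambda>i. const3 (a i) * Z + const3 (b i) * T) F"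
proof -
  have "homogenize T Z (tdeg e) (\<Prod>i \<in> UNIV. [:a i, b i:] ^ Poly_Mapping.lookup e i)
      = (\<Prod>i \<in> UNIV. (const3 (a i) * Z + const3 (b i) * T) ^ Poly_Mapping.lookup e i)" for e
  proof -
    \<comment> \<open>The \<open>0\<close> and the trailing factor \<open>1\<close> let one rule be
      applied once per variable, down to the constant polynomial with degree bound 0.\<close>
    have "homogenize T Z (0 + n3 + n2 + n1) ([:a 1, b 1:] ^ n1 * ([:a 2, b 2:] ^ n2 * ([:a 3, b 3:] ^ n3 * 1)))
      = (const3 (a 1) * Z + const3 (b 1) * T) ^ n1 * ((const3 (a 2) * Z + const3 (b 2) * T) ^ n2 *
        ((const3 (a 3) * Z + const3 (b 3) * T) ^ n3 * 1))" (is "?lhs n1 n2 n3 = ?rhs n1 n2 n3") for n1 n2 n3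
    proof -
      note mult = homogenize_linear_power_mult(1) and deg = homogenize_linear_power_mult(2)
      have 0: "degree (1 :: real poly) \<le> 0" by simp
      have "?lhs n1 n2 n3 = (const3 (a 1) * Z + const3 (b 1) * T) ^ n1 *
          homogenize T Z (0 + n3 + n2) ([:a 2, b 2:] ^ n2 * ([:a 3, b 3:] ^ n3 * 1))"
        by (rule mult) (rule deg[OF deg[OF 0]])
      also have "homogenize T Z (0 + n3 + n2) ([:a 2, b 2:] ^ n2 * ([:a 3, b 3:] ^ n3 * 1))
        = (const3 (a 2) * Z + const3 (b 2) * T) ^ n2 * homogenize T Z (0 + n3) ([:a 3, b 3:] ^ n3 * 1)"
        by (rule mult) (rule deg[OF 0])
      also have "homogenize T Z (0 + n3) ([:a 3, b 3:] ^ n3 * 1)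
        = (const3 (a 3) * Z + const3 (b 3) * T) ^ n3 * homogenize T Z 0 1"
        by (rule mult) (rule 0)
      also have "homogenize T Z 0 1 = 1" by (simp add: homogenize_def)
      finally show ?thesis .
    qed
    moreover have "tdeg e = 0 + Poly_Mapping.lookup e 3 + Poly_Mapping.lookup e 2 + Poly_Mapping.lookup e 1"
      unfolding sum_3 by linarith
    ultimately show ?thesis by (simp only: prod_UNIV_3 mult.assoc mult_1_right)
  qed
  then have monomial: "homogenize T Z d (\<Prod>i \<in> UNIV. [:a i, b i:] ^ Poly_Mapping.lookup e i)
      = (\<Prod>i \<in> UNIV. (const3 (a i) * Z + const3 (b i) * T) ^ Poly_Mapping.lookup e i)"
    if "tdeg e = d" for e
    unfolding that[symmetric] .
  have smult: "[:c:] * p = smult c p" for c and p :: "real poly" by simp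
  show ?thesis
    unfolding subst3_def homogenize_sum
  proof (rule sum.cong)
    fix e assume "e \<in> Poly_Mapping.keys F"
    then have "tdeg e = d" using hom by (simp add: homogeneous3_def)
    then show "homogenize T Z d ([:Poly_Mapping.lookup F e:] *
          (\<Prod>i \<in> UNIV. [:a i, b i:] ^ Poly_Mapping.lookup e i))
        = const3 (Poly_Mapping.lookup F e) *
          (\<Prod>i \<in> UNIV. (const3 (a i) * Z + const3 (b i) * T) ^ Poly_Mapping.lookup e i)"
      by (simp only: smult homogenize_smult monomial)
  qed (rule refl)
qed

text \<open>Homogeneous equation of the affine line through \<open>(p1, p2)\<close> with direction
  \<open>(d1, d2)\<close>.\<close>

definition line_form :: "real \<Rightarrow> real \<Rightarrow> real \<Rightarrow> real \<Rightarrow> poly3" where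
  "line_form p1 p2 d1 d2 =
     const3 d2 * (var3 1 - const3 p1 * var3 3) - const3 d1 * (var3 2 - const3 p2 * var3 3)"

text \<open>Modulo the form \<open>l\<close> of the line, the coordinates are the linear forms \<open>p1 * Z + d1 * T\<close>,
  \<open>p2 * Z + d2 * T\<close> and \<open>Z\<close>, so that \<open>F\<close> becomes the homogenization of its restriction to the line.\<close>

lemma line_form_dvd:
  assumes hom: "homogeneous3 d F" and dir: "d1 \<noteq> 0 \<or> d2 \<noteq> 0"
    and inf: "infinite {t. eval3 F (vector [p1 + t * d1, p2 + t * d2, 1]) = 0}"
  shows "line_form p1 p2 d1 d2 dvd F"
proof -
  let ?l = "line_form p1 p2 d1 d2"
  define Z where "Z = var3 3"
  define A where "A = var3 1 - const3 p1 * Z"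
  define B where "B = var3 2 - const3 p2 * Z"
  define i where "i = const3 (1 / (d1 * d1 + d2 * d2))"
  \<comment> \<open>Orthogonal projection of \<open>(A, B)\<close> to the direction: on the line,
    \<open>T\<close> is the parameter times \<open>Z\<close>, and the residues of \<open>A\<close>
    and \<open>B\<close> are multiples of the form of the line.\<close>
  define T where "T = i * (const3 d1 * A + const3 d2 * B)"
  define a b :: "3 \<Rightarrow> real" where "a j = (if j = 1 then p1 else if j = 2 then p2 else 1)"
    and "b j = (if j = 1 then d1 else if j = 2 then d2 else 0)" for j
  have l: "?l = const3 d2 * A - const3 d1 * B" by (simp add: line_form_def A_def B_def Z_def)
  have "d1 * d1 + d2 * d2 \<noteq> 0" using dir by (simp add: sum_squares_eq_zero_iff)
  then have unit: "i * (const3 d1 * const3 d1 + const3 d2 * const3 d2) = 1"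
    by (simp add: i_def mult_single flip: single_add)
  have "?l dvd var3 j - (const3 (a j) * Z + const3 (b j) * T)" for j
  proof -
    have "A - const3 d1 * T = i * const3 d2 * ?l" "B - const3 d2 * T = - (i * const3 d1) * ?l"
      unfolding T_def l using unit by algebra+
    then have "var3 1 - (const3 p1 * Z + const3 d1 * T) = i * const3 d2 * ?l"
      "var3 2 - (const3 p2 * Z + const3 d2 * T) = - (i * const3 d1) * ?l"
      by (simp_all add: A_def B_def diff_diff_eq)
    then show ?thesis
      using exhaust_3[of j] by (auto simp: a_def b_def Z_def)
  qed
  then have "?l dvd subst3 const3 var3 F - subst3 const3 (\<lambda>j. const3 (a j) * Z + const3 (b j) * T) F"
    by (rule dvd_subst3_diff)
  then have "?l dvd F - subst3 const3 (\<lambda>j. const3 (a j) * Z + const3 (b j) * T) F"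
    by (simp only: subst3_var3)
  moreover have "subst3 const3 (\<lambda>j. const3 (a j) * Z + const3 (b j) * T) F = 0"
  proof -
    define q where "q = subst3 (\<lambda>c. [:c:]) (\<lambda>j. [:a j, b j:]) F"
    have "poly q t = eval3 F (vector [p1 + t * d1, p2 + t * d2, 1])" for t
    proof -
      have "(\<chi> j. poly [:a j, b j:] t) = vector [p1 + t * d1, p2 + t * d2, 1]"
        by (simp add: vec_eq_iff forall_3 a_def b_def)
      then show ?thesis by (simp only: q_def poly_subst3)
    qed
    then have "q = 0" using inf poly_roots_finite[of q] by auto
    then show ?thesis
      using homogenize_subst3[OF hom, of T Z a b] by (simp add: q_def homogenize_zero)
  qed
  ultimately show ?thesis by simp
qed

lemma homogeneous3_line_form: "homogeneous3 1 (line_form p1 p2 d1 d2)"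
proof -
  have "tdeg (Poly_Mapping.single i 1) = 1" for i
    using exhaust_3[of i] by (auto simp: UNIV_3 lookup_single when_def)
  then have "graded (var3 i) = monom (var3 i) 1" for i by (simp only: graded_single)
  moreover have "graded (const3 c) = monom (const3 c) 0" for c by (simp only: graded_single) simp
  moreover have "graded (- F) = - graded F" for F
    using graded_add[of F "- F"] by (simp add: graded_def grade.subst_zero eq_neg_iff_add_eq_0 add.commute)
  then have "graded (F - G) = graded F - graded G" for F G
    using graded_add[of F "- G"] by simp
  ultimately show ?thesis
    unfolding homogeneous3_iff_graded line_form_def
    by (simp add: graded_mult mult_monom diff_monom del: mult_single)
qed

lemma line_form_nonzero:
  assumes "d1 \<noteq> 0 \<or> d2 \<noteq> 0" shows "line_form p1 p2 d1 d2 \<noteq> 0"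
proof
  assume "line_form p1 p2 d1 d2 = 0"
  have "(\<Prod>j \<in> UNIV. v $ j ^ Poly_Mapping.lookup (Poly_Mapping.single i 1) j)
      = (\<Prod>j \<in> UNIV. if j = i then v $ j else 1)" for i :: 3 and v :: "real ^ 3"
    by (rule prod.cong) (auto simp: lookup_single when_def)
  then have ev: "eval3 (var3 i) v = v $ i" "eval3 (const3 c) v = c" for i v c
    by (simp_all add: eval3_eq_subst3 eval3.subst_single)
  have neg: "eval3 (F - G) v = eval3 F v - eval3 G v" for F G v
    using eval3_add[of "F - G" G v] by simp
  \<comment> \<open>The witness is the base point shifted by the normal \<open>(d2, -d1)\<close>,
    where the form takes the squared length of the direction.\<close>
  have "eval3 (line_form p1 p2 d1 d2) (vector [p1 + d2, p2 - d1, 1]) = d2 * d2 + d1 * d1"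
    unfolding line_form_def by (simp only: neg eval3_mult ev vector_3) (simp add: algebra_simps)
  then have "d2 * d2 + d1 * d1 = 0" by (simp add: \<open>line_form _ _ _ _ = 0\<close> eval3_def)
  with assms show False by (simp add: sum_squares_eq_zero_iff)
qed

section \<open>Units and factorizations of forms\<close>

lemma homogeneous3_one: "homogeneous3 0 1"
  by (auto simp: homogeneous3_def)

lemma unit_homogeneous3:
  assumes "F dvd 1" shows "homogeneous3 0 F"
proof -
  obtain G where "1 = F * G" using assms by (rule dvdE)
  then show ?thesis
    using homogeneous3_factor[of 0 F G] homogeneous3_one by (metis add_is_0 zero_neq_one)
qed

lemma homogeneous3_0_unit:
  assumes "homogeneous3 0 F" "F \<noteq> 0" shows "F dvd 1"
proof -
  have "Poly_Mapping.keys F \<subseteq> {0}"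
  proof
    fix e assume "e \<in> Poly_Mapping.keys F"
    then have "tdeg e = 0" using assms(1) by (auto simp: homogeneous3_def)
    then have "e = 0" by (intro poly_mapping_eqI) simp
    then show "e \<in> {0}" by simp
  qed
  then have F: "F = const3 (Poly_Mapping.lookup F 0)"
    by (intro poly_mapping_eqI) (auto simp: lookup_single when_def in_keys_iff)
  then have "Poly_Mapping.lookup F 0 \<noteq> 0" using assms(2) by auto
  then have "F * const3 (1 / Poly_Mapping.lookup F 0) = 1"
    by (subst F) (simp add: mult_single)
  then show ?thesis by (metis dvd_triv_left)
qed

text \<open>An infinite intersection makes the form of the line a factor. It has degree 1 and the
  cofactor has degree \<open>d - 1 > 0\<close>, so neither is a unit.\<close>

lemma irreducible_finite_on_line:
  assumes irr: "irreducible F" and hom: "homogeneous3 d F" "d \<ge> 2" and dir: "d1 \<noteq> 0 \<or> d2 \<noteq> 0"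
  shows "finite {t. eval3 F (vector [p1 + t * d1, p2 + t * d2, 1]) = 0}"
proof (rule ccontr)
  let ?l = "line_form p1 p2 d1 d2"
  assume "infinite {t. eval3 F (vector [p1 + t * d1, p2 + t * d2, 1]) = 0}"
  then obtain G where G: "F = ?l * G" using line_form_dvd[OF hom(1) dir] by (blast elim: dvdE)
  have nz: "F \<noteq> 0" using irr by (auto simp: irreducible_def)
  obtain i j where ij: "homogeneous3 i ?l" "homogeneous3 j G" "i + j = d"
    using homogeneous3_factor[of d ?l G] hom nz G by metis
  have "i = 1"
    using homogeneous3_unique[OF ij(1) homogeneous3_line_form line_form_nonzero[OF dir]] .
  from irreducibleD[OF irr G] show False
  proof
    assume "?l dvd 1"
    then show False
      using homogeneous3_unique[OF unit_homogeneous3 homogeneous3_line_form line_form_nonzero[OF dir]] by simp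
  next
    assume "G dvd 1"
    moreover have "G \<noteq> 0" using nz G by auto
    ultimately have "j = 0" using homogeneous3_unique[OF ij(2) unit_homogeneous3] by simp
    with ij(3) \<open>i = 1\<close> hom(2) show False by simp
  qed
qed

lemma reducible_form_factors:
  assumes "\<not> irreducible F" "F \<noteq> 0" "homogeneous3 d F" "d > 0"
  obtains G H i j where "F = G * H" "homogeneous3 i G" "homogeneous3 j H" "i + j = d" "i > 0" "j > 0"
proof -
  have "\<not> F dvd 1"
    using homogeneous3_unique[OF assms(3) unit_homogeneous3 assms(2)] assms(4) by auto
  then obtain G H where GH: "F = G * H" "\<not> G dvd 1" "\<not> H dvd 1"
    using assms(1,2) by (auto simp: irreducible_def)
  then obtain i j where "homogeneous3 i G" "homogeneous3 j H" "i + j = d"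
    using homogeneous3_factor[of d G H] assms by metis
  moreover have "G \<noteq> 0" "H \<noteq> 0" using GH assms(2) by auto
  ultimately show ?thesis
    using that[of G H i j] GH homogeneous3_0_unit by (metis gr0I)
qed

section \<open>Zero loci in the projective plane\<close>

lemma eval3_scale:
  assumes "homogeneous3 d F" shows "eval3 F (c *\<^sub>R v) = c ^ d * eval3 F v"
proof -
  have "(\<Prod>i \<in> UNIV. (c *\<^sub>R v) $ i ^ Poly_Mapping.lookup e i)
      = c ^ tdeg e * (\<Prod>i \<in> UNIV. v $ i ^ Poly_Mapping.lookup e i)" for e
    by (simp add: power_mult_distrib prod.distrib power_sum)
  then show ?thesis
    using assms unfolding eval3_def sum_distrib_left
    by (intro sum.cong refl) (auto simp: homogeneous3_def)
qed

lemma rp2_representative: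
  obtains v where "v \<noteq> 0" "Rep_rp2 P = span {v}"
proof -
  have P: "subspace (Rep_rp2 P)" "dim (Rep_rp2 P) = 1" using Rep_rp2[of P] by auto
  obtain B where B: "B \<subseteq> Rep_rp2 P" "independent B" "Rep_rp2 P \<subseteq> span B" "card B = dim (Rep_rp2 P)"
    using basis_exists by blast
  then obtain v where v: "B = {v}" using P(2) card_1_singletonE by metis
  have "Rep_rp2 P = span {v}" using B P(1) v span_minimal by blast
  moreover have "v \<noteq> 0" using B(2) v by auto
  ultimately show ?thesis by (rule that[rotated])
qed

lemma in_zero_locus_iff:
  assumes "homogeneous3 d F" "Rep_rp2 P = span {v}"
  shows "P \<in> zero_locus F \<longleftrightarrow> eval3 F v = 0"
  using assms eval3_scale[OF assms(1)]
  by (auto simp: zero_locus_def span_singleton intro: exI[of _ 1])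

lemma zero_locus_mult:
  assumes "homogeneous3 i F" "homogeneous3 j G" "homogeneous3 d (F * G)"
  shows "zero_locus (F * G) = zero_locus F \<union> zero_locus G"
proof (rule set_eqI)
  fix P
  obtain v where v: "Rep_rp2 P = span {v}" using rp2_representative by blast
  show "P \<in> zero_locus (F * G) \<longleftrightarrow> P \<in> zero_locus F \<union> zero_locus G"
    using assms by (simp add: in_zero_locus_iff[OF _ v] eval3_mult)
qed

lemma of_affine_in_zero_locus:
  assumes "homogeneous3 d F"
  shows "of_affine p \<in> zero_locus F \<longleftrightarrow> eval3 F (vector [p $ 1, p $ 2, 1]) = 0"
proof -
  let ?v = "vector [p $ 1, p $ 2, 1] :: real ^ 3"
  have "?v $ 3 \<noteq> 0" by simp
  then have "?v \<noteq> 0" by (metis zero_index)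
  then have "dim (span {?v}) = 1" by (simp add: dim_singleton)
  then have "Rep_rp2 (of_affine p) = span {?v}"
    unfolding of_affine_def by (intro Abs_rp2_inverse) simp
  then show ?thesis by (rule in_zero_locus_iff[OF assms])
qed

section \<open>Colourings by mutually visible sets\<close>

lemma greedy_colouring:
  fixes R :: "'a \<Rightarrow> 'a \<Rightarrow> bool"
  assumes "finite X" and sym: "\<And>p q. R p q \<Longrightarrow> R q p"
    and "\<And>p. p \<in> X \<Longrightarrow> card {q \<in> X. R p q} \<le> d"
  obtains c where "\<And>p. p \<in> X \<Longrightarrow> c p < Suc d"
    "\<And>p q. p \<in> X \<Longrightarrow> q \<in> X \<Longrightarrow> p \<noteq> q \<Longrightarrow> R p q \<Longrightarrow> c p \<noteq> (c q :: nat)"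
proof -
  have "\<exists>c. (\<forall>p \<in> X. c p < Suc d) \<and> (\<forall>p \<in> X. \<forall>q \<in> X. p \<noteq> q \<longrightarrow> R p q \<longrightarrow> c p \<noteq> c q)"
    using assms(1,3)
  proof (induction X rule: finite_induct)
    case (insert x X)
    have deg: "card {q \<in> X. R p q} \<le> d" if "p \<in> X" for p
    proof -
      have "card {q \<in> X. R p q} \<le> card {q \<in> insert x X. R p q}"
        using insert.hyps by (intro card_mono) auto
      also have "\<dots> \<le> d" using insert.prems that by blast
      finally show ?thesis .
    qed
    have "\<exists>c. (\<forall>p \<in> X. c p < Suc d) \<and> (\<forall>p \<in> X. \<forall>q \<in> X. p \<noteq> q \<longrightarrow> R p q \<longrightarrow> c p \<noteq> c q)"
      by (rule insert.IH) (rule deg)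
    then obtain c where c: "\<forall>p \<in> X. c p < Suc d"
      "\<forall>p \<in> X. \<forall>q \<in> X. p \<noteq> q \<longrightarrow> R p q \<longrightarrow> c p \<noteq> c q"
      by (elim exE conjE)
    let ?N = "{q \<in> X. R x q}"
    have "card (c ` ?N) \<le> card ?N" using insert.hyps by (intro card_image_le) simp
    also have "card ?N \<le> card {q \<in> insert x X. R x q}"
      using insert.hyps by (intro card_mono) auto
    also have "\<dots> \<le> d" using insert.prems by blast
    finally have "card (c ` ?N) < card {..<Suc d}" by simp
    then have "\<not> {..<Suc d} \<subseteq> c ` ?N"
      using card_mono[of "c ` ?N" "{..<Suc d}"] insert.hyps by auto
    then obtain i where i: "i < Suc d" "i \<notin> c ` ?N" by blast
    have "(c(x := i)) p < Suc d" if "p \<in> insert x X" for p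
      using c(1) i(1) that by auto
    moreover have "(c(x := i)) p \<noteq> (c(x := i)) q"
      if "p \<in> insert x X" "q \<in> insert x X" "p \<noteq> q" "R p q" for p q
    proof (cases "p = x")
      case True
      then show ?thesis using that i(2) by auto
    next
      case p: False
      show ?thesis
      proof (cases "q = x")
        case True
        then have "p \<in> ?N" using that p sym[of p q] by simp
        then show ?thesis using i(2) True p by auto
      next
        case False
        then show ?thesis using that p c(2) by auto
      qed
    qed
    ultimately show ?case by (intro exI[of _ "c(x := i)"] conjI ballI impI)
  qed simp
  then obtain c where "\<forall>p \<in> X. c p < Suc d"
    "\<forall>p \<in> X. \<forall>q \<in> X. p \<noteq> q \<longrightarrow> R p q \<longrightarrow> c p \<noteq> c q" by (elim exE conjE)
  then show ?thesis by (intro that[of c]) auto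
qed

text \<open>The point \<open>b\<close> determines the ray from \<open>p\<close> on which both
  \<open>q\<close> and \<open>q'\<close> lie, and the nearer of the two is between \<open>p\<close>
  and the other.\<close>

lemma open_segments_common_point:
  fixes p q q' b :: "'a::real_vector"
  assumes "b \<in> open_segment p q" "b \<in> open_segment p q'" "q \<noteq> q'"
  shows "q' \<in> open_segment p q \<or> q \<in> open_segment p q'"
proof -
  have *: "q' \<in> open_segment p q"
    if pq: "p \<noteq> q" and u: "0 < u" "u < u'" and eq: "u *\<^sub>R (q - p) = u' *\<^sub>R (q' - p)"
    for q q' :: 'a and u u' :: real
  proof -
    have "u' \<noteq> 0" using u by simp
    have "q' - p = (1 / u') *\<^sub>R (u' *\<^sub>R (q' - p))" using \<open>u' \<noteq> 0\<close> by simp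
    also have "\<dots> = (u / u') *\<^sub>R (q - p)" unfolding eq[symmetric] by simp
    finally have "q' = (1 - u / u') *\<^sub>R p + (u / u') *\<^sub>R q" by (simp add: algebra_simps)
    moreover have "0 < u / u'" "u / u' < 1" using u by simp_all
    ultimately show ?thesis using pq unfolding in_segment by blast
  qed
  obtain u where u: "p \<noteq> q" "0 < u" "b = (1 - u) *\<^sub>R p + u *\<^sub>R q"
    using assms(1) unfolding in_segment by blast
  obtain u' where u': "p \<noteq> q'" "0 < u'" "b = (1 - u') *\<^sub>R p + u' *\<^sub>R q'"
    using assms(2) unfolding in_segment by blast
  have eq: "u *\<^sub>R (q - p) = u' *\<^sub>R (q' - p)"
    using u(3) u'(3) by (simp add: algebra_simps)
  consider "u < u'" | "u' < u" | "u = u'" by linarith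
  then show ?thesis
  proof cases
    case 3
    with eq u have "q = q'" by simp
    with assms show ?thesis by simp
  next
    case 1
    then show ?thesis using *[OF u(1,2) _ eq] by blast
  next
    case 2
    then show ?thesis using *[OF u'(1,2) _ eq[symmetric]] by blast
  qed
qed

text \<open>Colourings may have empty classes, unlike partitions, so the numbers of colours simply
  add up in unions.\<close>

definition visibly_colourable :: "(real ^ 2) set \<Rightarrow> (real ^ 2) set \<Rightarrow> nat \<Rightarrow> bool" where
  "visibly_colourable A Y n \<longleftrightarrow> (\<exists>c. (\<forall>p \<in> Y. c p < n) \<and>
     (\<forall>p \<in> Y. \<forall>q \<in> Y. p \<noteq> q \<longrightarrow> c p = c q \<longrightarrow> visible A p q))"

lemma visibly_colourableI:
  assumes "\<And>p. p \<in> Y \<Longrightarrow> c p < n"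
    and "\<And>p q. p \<in> Y \<Longrightarrow> q \<in> Y \<Longrightarrow> p \<noteq> q \<Longrightarrow> c p = c q \<Longrightarrow> visible A p q"
  shows "visibly_colourable A Y n"
  using assms unfolding visibly_colourable_def by blast

lemma visibly_colourableE:
  assumes "visibly_colourable A Y n"
  obtains c where "\<And>p. p \<in> Y \<Longrightarrow> c p < n"
    "\<And>p q. p \<in> Y \<Longrightarrow> q \<in> Y \<Longrightarrow> p \<noteq> q \<Longrightarrow> c p = c q \<Longrightarrow> visible A p q"
  using assms unfolding visibly_colourable_def by blast

text \<open>Every blocker of a chord of \<open>X\<close> lies outside \<open>Z\<close>, and for a fixed endpoint it blocks at
  most one chord, so the graph of invisible pairs has small maximum degree.\<close>

lemma visibly_colourable_off_curve:
  assumes A: "finite A" and X: "X \<subseteq> A" "X \<subseteq> Z"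
    and seg: "\<And>p q. p \<in> X \<Longrightarrow> q \<in> X \<Longrightarrow> p \<noteq> q \<Longrightarrow> open_segment p q \<inter> Z = {}"
    and card: "card (A - Z) \<le> d"
  shows "visibly_colourable A X (Suc d)"
proof -
  let ?R = "\<lambda>p q. p \<noteq> q \<and> \<not> visible A p q"
  have "card {q \<in> X. ?R p q} \<le> d" if p: "p \<in> X" for p
  proof -
    have "\<forall>q \<in> {q \<in> X. ?R p q}. \<exists>b. b \<in> open_segment p q \<and> b \<in> A"
      by (auto simp: visible_def)
    from bchoice[OF this] obtain b
      where b: "\<forall>q \<in> {q \<in> X. ?R p q}. b q \<in> open_segment p q \<and> b q \<in> A" by (rule exE)
    have "inj_on b {q \<in> X. ?R p q}"
    proof (rule inj_onI, rule ccontr)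
      fix q q' assume q: "q \<in> {q \<in> X. ?R p q}" "q' \<in> {q \<in> X. ?R p q}" "b q = b q'" "q \<noteq> q'"
      have "q' \<in> open_segment p q \<or> q \<in> open_segment p q'"
        using open_segments_common_point[of "b q" p q q'] bspec[OF b q(1)] bspec[OF b q(2)] q(3,4) by simp
      \<comment> \<open>A shared blocker would put one of \<open>q\<close>, \<open>q'\<close> on an
        open chord of \<open>X\<close>, although both lie in \<open>Z\<close>.\<close>
      then show False using seg[of p q] seg[of p q'] p q X by auto
    qed
    moreover have "b ` {q \<in> X. ?R p q} \<subseteq> A - Z"
      using b seg[OF p] by fastforce
    ultimately have "card {q \<in> X. ?R p q} \<le> card (A - Z)"
      using A by (intro card_inj_on_le) auto
    with card show ?thesis by simp
  qed
  note degree = this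
  have sym: "?R q p" if "?R p q" for p q
    using that by (auto simp: visible_def open_segment_commute)
  have "finite X" using X(1) A by (rule finite_subset)
  then obtain c where c: "\<And>p. p \<in> X \<Longrightarrow> c p < Suc d"
    "\<And>p q. p \<in> X \<Longrightarrow> q \<in> X \<Longrightarrow> p \<noteq> q \<Longrightarrow> ?R p q \<Longrightarrow> c p \<noteq> c q"
    by (rule greedy_colouring[of X ?R, OF _ sym degree]) (assumption | rule that)+
  show ?thesis by (rule visibly_colourableI[of X c]) (use c in blast)+
qed

lemma visibly_colourable_Un:
  assumes "visibly_colourable A Y n" "visibly_colourable A Y' n'"
  shows "visibly_colourable A (Y \<union> Y') (n + n')"
proof -
  obtain c where c: "\<And>p. p \<in> Y \<Longrightarrow> c p < n"
    "\<And>p q. p \<in> Y \<Longrightarrow> q \<in> Y \<Longrightarrow> p \<noteq> q \<Longrightarrow> c p = c q \<Longrightarrow> visible A p q"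
    using assms(1) by (rule visibly_colourableE) blast
  obtain c' where c': "\<And>p. p \<in> Y' \<Longrightarrow> c' p < n'"
    "\<And>p q. p \<in> Y' \<Longrightarrow> q \<in> Y' \<Longrightarrow> p \<noteq> q \<Longrightarrow> c' p = c' q \<Longrightarrow> visible A p q"
    using assms(2) by (rule visibly_colourableE) blast
  let ?c = "\<lambda>p. if p \<in> Y then c p else n + c' p"
  show ?thesis
  proof (rule visibly_colourableI[of _ ?c])
    show "?c p < n + n'" if "p \<in> Y \<union> Y'" for p
      using c(1)[of p] c'(1)[of p] that by auto
    show "visible A p q" if pq: "p \<in> Y \<union> Y'" "q \<in> Y \<union> Y'" "p \<noteq> q" "?c p = ?c q" for p q
    proof (cases "p \<in> Y \<longleftrightarrow> q \<in> Y")
      case True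
      then show ?thesis using pq c(2)[of p q] c'(2)[of p q] by (auto split: if_splits)
    next
      case False
      then show ?thesis using pq c(1)[of p] c(1)[of q] by (auto split: if_splits)
    qed
  qed
qed

text \<open>One colour per point, as used for the points of the line and for the exceptional
  points.\<close>

lemma visibly_colourable_card:
  assumes "finite Y" shows "visibly_colourable A Y (card Y)"
proof -
  obtain c where c: "bij_betw c Y {0..<card Y}" using ex_bij_betw_finite_nat[OF assms] by blast
  show ?thesis
    by (rule visibly_colourableI[of _ c]) (use c in \<open>auto simp: bij_betw_def inj_on_def\<close>)
qed

lemma visibly_colourable_UN:
  assumes "\<And>i. i < k \<Longrightarrow> visibly_colourable A (Y i) n"
  shows "visibly_colourable A (\<Union>i < k. Y i) (k * n)"
  using assms
proof (induction k)
  case 0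
  then show ?case by (simp add: visibly_colourable_def)
next
  case (Suc k)
  have "visibly_colourable A (Y k \<union> (\<Union>i < k. Y i)) (n + k * n)"
    using Suc by (intro visibly_colourable_Un) auto
  then show ?case by (simp add: lessThan_Suc)
qed

lemma visibly_colourable_partition:
  assumes "visibly_colourable A Y n" "finite Y" "Y \<subseteq> A"
  obtains P where "visible_partition A Y P" "card P \<le> n"
proof -
  obtain c where c: "\<And>p. p \<in> Y \<Longrightarrow> c p < n"
    "\<And>p q. p \<in> Y \<Longrightarrow> q \<in> Y \<Longrightarrow> p \<noteq> q \<Longrightarrow> c p = c q \<Longrightarrow> visible A p q"
    using assms(1) by (rule visibly_colourableE) blast
  define P where "P = (\<lambda>i. {p \<in> Y. c p = i}) ` c ` Y"
  have "partition_on Y P"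
    unfolding partition_on_def disjoint_def P_def by auto
  moreover have "mutually_visible A B" if "B \<in> P" for B
    using that assms(3) c(2) by (auto simp: P_def mutually_visible_def)
  ultimately have "visible_partition A Y P"
    using assms(2) by (simp add: visible_partition_def P_def)
  moreover have "card P \<le> n"
  proof -
    have "card P \<le> card (c ` Y)" unfolding P_def using assms(2) by (intro card_image_le) simp
    also have "\<dots> \<le> card {..<n}" using c(1) by (intro card_mono) auto
    finally show ?thesis by simp
  qed
  ultimately show ?thesis by (rule that)
qed

lemma visible_partition_number_le:
  assumes "visibly_colourable A Y n" "finite Y" "Y \<subseteq> A"
  shows "visible_partition_number A Y \<le> n"
proof -
  obtain P where P: "visible_partition A Y P" "card P \<le> n"
    using visibly_colourable_partition[OF assms] .
  have "visible_partition_number A Y \<le> card P"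
    unfolding visible_partition_number_def by (rule Least_le) (use P in blast)
  with P show ?thesis by simp
qed

lemma card_mutually_visible_le:
  assumes "finite A" "mutually_visible A B"
  shows "card B \<le> clique_number (visibility_graph A)"
proof -
  have "finite (card ` {C. C \<subseteq> A \<and> clique C (snd (visibility_graph A))})"
    using assms(1) by simp
  moreover have "clique B (snd (visibility_graph A))"
    using assms(2) unfolding clique_def visibility_graph_def mutually_visible_def snd_conv by blast
  ultimately show ?thesis
    using assms(2) unfolding clique_number_def
    by (intro Max_ge) (auto simp: visibility_graph_def mutually_visible_def)
qed

lemma card_le_clique_number:
  assumes "visibly_colourable A Y n" "finite A" "Y \<subseteq> A"
  shows "card Y \<le> n * clique_number (visibility_graph A)"
proof -
  obtain c where c: "\<And>p. p \<in> Y \<Longrightarrow> c p < n"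
    "\<And>p q. p \<in> Y \<Longrightarrow> q \<in> Y \<Longrightarrow> p \<noteq> q \<Longrightarrow> c p = c q \<Longrightarrow> visible A p q"
    using assms(1) by (rule visibly_colourableE) blast
  have "card (\<Union>i \<in> {..<n}. {p \<in> Y. c p = i}) \<le> (\<Sum>i \<in> {..<n}. card {p \<in> Y. c p = i})"
    by (rule card_UN_le) simp
  moreover have "(\<Union>i \<in> {..<n}. {p \<in> Y. c p = i}) = Y" using c(1) by auto
  ultimately have "card Y \<le> (\<Sum>i \<in> {..<n}. card {p \<in> Y. c p = i})" by (simp only:)
  also have "\<dots> \<le> (\<Sum>i \<in> {..<n}. clique_number (visibility_graph A))"
    using assms(2,3) c(2)
    by (intro sum_mono card_mutually_visible_le) (auto simp: mutually_visible_def)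
  finally show ?thesis by simp
qed

section \<open>Curves and lines\<close>

lemma restriction_to_line_poly:
  assumes hom: "homogeneous3 d F"
  obtains q where "degree q \<le> d"
    "\<And>t. poly q t = eval3 F (vector [p1 + t * d1, p2 + t * d2, 1])"
proof -
  define a b :: "3 \<Rightarrow> real" where "a j = (if j = 1 then p1 else if j = 2 then p2 else 1)"
    and "b j = (if j = 1 then d1 else if j = 2 then d2 else 0)" for j
  define q where "q = subst3 (\<lambda>c. [:c:]) (\<lambda>j. [:a j, b j:]) F"
  have "poly q t = eval3 F (vector [p1 + t * d1, p2 + t * d2, 1])" for t
  proof -
    have "(\<chi> j. poly [:a j, b j:] t) = vector [p1 + t * d1, p2 + t * d2, 1]"
      by (simp add: vec_eq_iff forall_3 a_def b_def)
    then show ?thesis by (simp only: q_def poly_subst3)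
  qed
  moreover have "degree q \<le> d"
    unfolding q_def subst3_def
  proof (intro degree_sum_le finite_keys)
    fix e assume e: "e \<in> Poly_Mapping.keys F"
    have "degree (\<Prod>i \<in> UNIV. [:a i, b i:] ^ Poly_Mapping.lookup e i)
        \<le> (\<Sum>i \<in> UNIV. degree ([:a i, b i:] ^ Poly_Mapping.lookup e i))"
      by (rule order.trans[OF degree_prod_sum_le]) (simp_all add: o_def)
    also have "\<dots> \<le> tdeg e"
    proof (rule sum_mono)
      fix i :: 3
      have "degree ([:a i, b i:] ^ Poly_Mapping.lookup e i) \<le> degree [:a i, b i:] * Poly_Mapping.lookup e i"
        by (rule degree_power_le)
      also have "\<dots> \<le> 1 * Poly_Mapping.lookup e i" by (rule mult_le_mono1) simp
      finally show "degree ([:a i, b i:] ^ Poly_Mapping.lookup e i) \<le> Poly_Mapping.lookup e i" by simp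
    qed
    finally show "degree ([:Poly_Mapping.lookup F e:] *
        (\<Prod>i \<in> UNIV. [:a i, b i:] ^ Poly_Mapping.lookup e i)) \<le> d"
      using hom e by (auto simp: homogeneous3_def intro!: order.trans[OF degree_mult_le])
  qed
  ultimately show ?thesis by (intro that)
qed

text \<open>The form restricts to the chord line as a nonzero polynomial of degree at most 2 with
  roots at the parameters 0 and 1, which leaves no third root.\<close>

lemma irreducible_conic_chord:
  assumes irr: "irreducible F" and hom: "homogeneous3 2 F" and "p \<noteq> q"
    and zero: "eval3 F (vector [p $ 1, p $ 2, 1]) = 0" "eval3 F (vector [q $ 1, q $ 2, 1]) = 0"
    and r: "r \<in> open_segment p (q :: real ^ 2)"
  shows "eval3 F (vector [r $ 1, r $ 2, 1]) \<noteq> 0"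
proof
  assume r0: "eval3 F (vector [r $ 1, r $ 2, 1]) = 0"
  obtain u where u: "0 < u" "u < 1" "r = (1 - u) *\<^sub>R p + u *\<^sub>R q"
    using r by (auto simp: in_segment)
  let ?d = "q - p"
  obtain g where g: "degree g \<le> 2"
    "\<And>t. poly g t = eval3 F (vector [p $ 1 + t * ?d $ 1, p $ 2 + t * ?d $ 2, 1])"
    using restriction_to_line_poly[OF hom] by blast
  have "?d $ 1 \<noteq> 0 \<or> ?d $ 2 \<noteq> 0" using \<open>p \<noteq> q\<close> by (auto simp: vec_eq_iff forall_2)
  from irreducible_finite_on_line[OF irr hom _ this, of "p $ 1" "p $ 2"]
  have "finite {t. poly g t = 0}" by (simp only: g(2))
  then have "g \<noteq> 0" by (auto simp: infinite_UNIV_char_0)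
  have "r $ 1 = p $ 1 + u * ?d $ 1" "r $ 2 = p $ 2 + u * ?d $ 2" by (simp_all add: u(3) algebra_simps)
  then have "poly g 0 = 0" "poly g u = 0" "poly g 1 = 0" using zero r0 by (simp_all add: g(2))
  then have "{0, u, 1} \<subseteq> {t. poly g t = 0}" by simp
  then have "card {0, u, 1} \<le> card {t. poly g t = 0}"
    by (rule card_mono[OF \<open>finite {t. poly g t = 0}\<close>])
  also have "\<dots> \<le> degree g" by (rule card_poly_roots_bound) fact
  finally show False using g(1) u by simp
qed

lemma cubic_form_affine:
  assumes "homogeneous3 3 F"
  obtains k30 k21 k12 k03 k20 k11 k02 k10 k01 k00 where
    "\<And>x y. eval3 F (vector [x, y, 1]) = k30 * x ^ 3 + k21 * x\<^sup>2 * y + k12 * x * y\<^sup>2 + k03 * y ^ 3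
    + k20 * x\<^sup>2 + k11 * x * y + k02 * y\<^sup>2 + k10 * x + k01 * y + k00"
proof -
  \<comment> \<open>An existential over the ten coefficients is closed under addition, which permits
    induction over the support of \<open>F\<close> without naming its coefficients.\<close>
  define cubic :: "(real \<Rightarrow> real \<Rightarrow> real) \<Rightarrow> bool" where
    "cubic f \<longleftrightarrow> (\<exists>k30 k21 k12 k03 k20 k11 k02 k10 k01 k00. \<forall>x y. f x y = k30 * x ^ 3
      + k21 * x\<^sup>2 * y + k12 * x * y\<^sup>2 + k03 * y ^ 3 + k20 * x\<^sup>2 + k11 * x * y + k02 * y\<^sup>2
      + k10 * x + k01 * y + k00)" for f
  have cubicI: "cubic f" if "\<And>x y. f x y = k30 * x ^ 3
      + k21 * x\<^sup>2 * y + k12 * x * y\<^sup>2 + k03 * y ^ 3 + k20 * x\<^sup>2 + k11 * x * y + k02 * y\<^sup>2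
      + k10 * x + k01 * y + k00" for f k30 k21 k12 k03 k20 k11 k02 k10 k01 k00
    unfolding cubic_def by (intro exI allI) (rule that)
  have add: "cubic (\<lambda>x y. f x y + g x y)" if f: "cubic f" and g: "cubic g" for f g
  proof -
    obtain k30 k21 k12 k03 k20 k11 k02 k10 k01 k00 where k: "\<And>x y. f x y = k30 * x ^ 3
      + k21 * x\<^sup>2 * y + k12 * x * y\<^sup>2 + k03 * y ^ 3 + k20 * x\<^sup>2 + k11 * x * y + k02 * y\<^sup>2
      + k10 * x + k01 * y + k00" using f unfolding cubic_def by (elim exE) (rule that, drule spec, erule spec)
    obtain l30 l21 l12 l03 l20 l11 l02 l10 l01 l00 where l: "\<And>x y. g x y = l30 * x ^ 3
      + l21 * x\<^sup>2 * y + l12 * x * y\<^sup>2 + l03 * y ^ 3 + l20 * x\<^sup>2 + l11 * x * y + l02 * y\<^sup>2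
      + l10 * x + l01 * y + l00" using g unfolding cubic_def by (elim exE) (rule that, drule spec, erule spec)
    show ?thesis
      by (rule cubicI[of _ "k30 + l30" "k21 + l21" "k12 + l12" "k03 + l03" "k20 + l20" "k11 + l11"
            "k02 + l02" "k10 + l10" "k01 + l01" "k00 + l00"]) (simp add: k l distrib_right)
  qed
  have monomial: "cubic (\<lambda>x y. c * (x ^ i * y ^ j))" if "i + j \<le> 3" for c i j
  proof -
    have "i = 3 \<and> j = 0 \<or> i = 2 \<and> j = 1 \<or> i = 1 \<and> j = 2 \<or> i = 0 \<and> j = 3 \<or> i = 2 \<and> j = 0
      \<or> i = 1 \<and> j = 1 \<or> i = 0 \<and> j = 2 \<or> i = 1 \<and> j = 0 \<or> i = 0 \<and> j = 1 \<or> i = 0 \<and> j = 0"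
      using that by arith
    then show ?thesis
      by (intro cubicI[of _ "if i = 3 \<and> j = 0 then c else 0" "if i = 2 \<and> j = 1 then c else 0"
            "if i = 1 \<and> j = 2 then c else 0" "if i = 0 \<and> j = 3 then c else 0"
            "if i = 2 \<and> j = 0 then c else 0" "if i = 1 \<and> j = 1 then c else 0"
            "if i = 0 \<and> j = 2 then c else 0" "if i = 1 \<and> j = 0 then c else 0"
            "if i = 0 \<and> j = 1 then c else 0" "if i = 0 \<and> j = 0 then c else 0"]) auto
  qed
  have "cubic (\<lambda>x y. \<Sum>e \<in> E. Poly_Mapping.lookup F e *
      (\<Prod>i \<in> UNIV. (vector [x, y, 1] :: real ^ 3) $ i ^ Poly_Mapping.lookup e i))"
    if "finite E" "E \<subseteq> Poly_Mapping.keys F" for E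
    using that
  proof (induction E rule: finite_induct)
    case empty
    show ?case by (rule cubicI[of _ 0 0 0 0 0 0 0 0 0 0]) simp
  next
    case (insert e E)
    have "tdeg e = 3" using insert.prems assms by (simp add: homogeneous3_def)
    then have "Poly_Mapping.lookup e 1 + Poly_Mapping.lookup e 2 \<le> 3" by (simp add: sum_3)
    from monomial[OF this, of "Poly_Mapping.lookup F e"]
    have "cubic (\<lambda>x y. Poly_Mapping.lookup F e *
      (\<Prod>i \<in> UNIV. (vector [x, y, 1] :: real ^ 3) $ i ^ Poly_Mapping.lookup e i))"
      by (simp add: prod_UNIV_3)
    from add[OF this insert.IH] insert show ?case by simp
  qed
  from this[OF finite_keys order_refl] have "cubic (\<lambda>x y. eval3 F (vector [x, y, 1]))"
    unfolding eval3_def .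
  then show ?thesis unfolding cubic_def by (elim exE) (rule that, drule spec, erule spec)
qed

lemma linear_form_eval3:
  assumes hom: "homogeneous3 1 F" and "F \<noteq> 0"
  obtains \<alpha> where "\<And>v. eval3 F v = (\<Sum>i \<in> UNIV. \<alpha> i * v $ i)" "\<exists>i. \<alpha> i \<noteq> 0"
proof -
  let ?s = "\<lambda>i :: 3. Poly_Mapping.single i (1 :: nat)"
  have keys: "Poly_Mapping.keys F \<subseteq> range ?s"
  proof
    fix e assume "e \<in> Poly_Mapping.keys F"
    then have deg: "tdeg e = 1" using hom by (simp add: homogeneous3_def)
    then obtain i where i: "Poly_Mapping.lookup e i \<noteq> 0" by (metis sum.neutral zero_neq_one)
    have "Poly_Mapping.lookup e i + (\<Sum>j \<in> UNIV - {i}. Poly_Mapping.lookup e j) = 1"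
      using deg by (metis finite sum.remove UNIV_I)
    with i have "Poly_Mapping.lookup e i = 1" "(\<Sum>j \<in> UNIV - {i}. Poly_Mapping.lookup e j) = 0"
      by linarith+
    then have "e = ?s i" by (intro poly_mapping_eqI) (auto simp: lookup_single when_def)
    then show "e \<in> range ?s" by blast
  qed
  have mon: "(\<Prod>j \<in> UNIV. v $ j ^ Poly_Mapping.lookup (?s i) j) = v $ i" for v :: "real ^ 3" and i
  proof -
    have "(\<Prod>j \<in> UNIV. v $ j ^ Poly_Mapping.lookup (?s i) j) = (\<Prod>j \<in> UNIV. if j = i then v $ j else 1)"
      by (rule prod.cong) (auto simp: lookup_single when_def)
    then show ?thesis by simp
  qed
  have "eval3 F v = (\<Sum>i \<in> UNIV. Poly_Mapping.lookup F (?s i) * v $ i)" for v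
  proof -
    have "eval3 F v = (\<Sum>e \<in> range ?s. Poly_Mapping.lookup F e *
        (\<Prod>i \<in> UNIV. v $ i ^ Poly_Mapping.lookup e i))"
      unfolding eval3_def using keys by (intro sum.mono_neutral_left) (auto simp: in_keys_iff)
    also have "\<dots> = (\<Sum>i \<in> UNIV. Poly_Mapping.lookup F (?s i) *
        (\<Prod>j \<in> UNIV. v $ j ^ Poly_Mapping.lookup (?s i) j))"
      by (subst sum.reindex) (auto intro!: inj_onI dest: arg_cong[of _ _ Poly_Mapping.keys])
    finally show ?thesis unfolding mon .
  qed
  moreover have "\<exists>i. Poly_Mapping.lookup F (?s i) \<noteq> 0"
  proof -
    obtain e where "e \<in> Poly_Mapping.keys F" using assms(2) by (metis equals0I keys_eq_empty)
    then show ?thesis using keys by (auto simp: in_keys_iff)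
  qed
  ultimately show ?thesis by (rule that)
qed

lemma collinear_points_on_line:
  assumes "projective_line L"
  shows "collinear (points_on A L)"
proof -
  obtain F where F: "F \<noteq> 0" "homogeneous3 1 F" "L = zero_locus F"
    using assms unfolding projective_curve_def by blast
  obtain \<alpha> where \<alpha>: "\<And>v. eval3 F v = (\<Sum>i \<in> UNIV. \<alpha> i * v $ i)" "\<exists>i. \<alpha> i \<noteq> 0"
    using linear_form_eval3[OF F(2,1)] by blast
  have eq: "\<alpha> 1 * p $ 1 + \<alpha> 2 * p $ 2 + \<alpha> 3 = 0" if "p \<in> points_on A L" for p
    using that by (simp add: points_on_def F(3) of_affine_in_zero_locus[OF F(2)] \<alpha>(1) sum_3)
  show ?thesis
    unfolding collinear_def
  proof (rule exI[of _ "vector [- \<alpha> 2, \<alpha> 1]"], intro ballI)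
    fix p q assume pq: "p \<in> points_on A L" "q \<in> points_on A L"
    have *: "\<alpha> 1 * (p - q) $ 1 + \<alpha> 2 * (p - q) $ 2 = 0"
      using eq[OF pq(1)] eq[OF pq(2)] by (simp add: algebra_simps)
    \<comment> \<open>Otherwise the line is the one at infinity, which contains no affine point such
      as \<open>p\<close>.\<close>
    have "\<alpha> 1 \<noteq> 0 \<or> \<alpha> 2 \<noteq> 0"
    proof (rule ccontr)
      assume no: "\<not> ?thesis"
      then have "\<alpha> 3 = 0" using eq[OF pq(1)] by simp
      with no \<alpha>(2) show False by (metis exhaust_3)
    qed
    then show "\<exists>c. p - q = c *\<^sub>R vector [- \<alpha> 2, \<alpha> 1]"
    proof
      assume a1: "\<alpha> 1 \<noteq> 0"
      have "p - q = ((p - q) $ 2 / \<alpha> 1) *\<^sub>R vector [- \<alpha> 2, \<alpha> 1]"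
        using * a1 by (simp add: vec_eq_iff forall_2 field_simps)
      then show ?thesis ..
    next
      assume a2: "\<alpha> 2 \<noteq> 0"
      have "p - q = (- (p - q) $ 1 / \<alpha> 2) *\<^sub>R vector [- \<alpha> 2, \<alpha> 1]"
        using * a2 by (simp add: vec_eq_iff forall_2 field_simps)
      then show ?thesis ..
    qed
  qed
qed

lemma card_points_on_line_less:
  assumes "finite A" "\<not> (\<exists>B \<subseteq> A. card B = k \<and> collinear B)" "projective_line L"
  shows "card (points_on A L) < k"
proof (rule ccontr)
  assume "\<not> card (points_on A L) < k"
  then obtain B where B: "B \<subseteq> points_on A L" "card B = k"
    using obtain_subset_with_card_n[of k "points_on A L"] by (auto simp: not_less)
  moreover have "B \<subseteq> A" using B(1) by (auto simp: points_on_def)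
  moreover have "collinear B"
    using collinear_points_on_line[OF assms(3)] B(1) by (rule collinear_subset)
  ultimately show False using assms(2) by blast
qed

lemma points_on_Un: "points_on A (C \<union> D) = points_on A C \<union> points_on A D"
  by (auto simp: points_on_def)

text \<open>A chord of the conic can be blocked by points off the cubic and also by points of the
  line, which explains the summand for \<open>L\<close>.\<close>

lemma visibly_colourable_conic:
  assumes A: "finite A" and Q: "irreducible_conic Q"
  shows "visibly_colourable A (points_on A Q)
    (card (A - points_on A (Q \<union> L)) + card (points_on A L) + 1)"
proof -
  obtain F where F: "irreducible F" "homogeneous3 2 F" "Q = zero_locus F"
    using Q unfolding irreducible_projective_curve_def by blast
  let ?Z = "{p. of_affine p \<in> Q}"
  have Z: "of_affine p \<in> Q \<longleftrightarrow> eval3 F (vector [p $ 1, p $ 2, 1]) = 0" for p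
    unfolding F(3) by (rule of_affine_in_zero_locus[OF F(2)])
  have "card (A - ?Z) \<le> card ((A - points_on A (Q \<union> L)) \<union> points_on A L)"
    using A by (intro card_mono) (auto simp: points_on_def)
  also have "\<dots> \<le> card (A - points_on A (Q \<union> L)) + card (points_on A L)"
    by (rule card_Un_le)
  finally have "visibly_colourable A (points_on A Q)
      (Suc (card (A - points_on A (Q \<union> L)) + card (points_on A L)))"
  proof (rule visibly_colourable_off_curve[OF A, rotated -1])
    show "points_on A Q \<subseteq> A" "points_on A Q \<subseteq> ?Z" by (auto simp: points_on_def)
    show "open_segment p q \<inter> ?Z = {}"
      if "p \<in> points_on A Q" "q \<in> points_on A Q" "p \<noteq> q" for p q
      using that irreducible_conic_chord[OF F(1,2)] by (auto simp: points_on_def Z)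
  qed
  then show ?thesis by simp
qed

text \<open>The 15 arc classes are coloured separately. The exceptional points stay outside because
  the clique bound discards them while the partition makes singletons of them.\<close>

lemma visibly_colourable_irreducible_cubic:
  assumes A: "finite A" and \<Gamma>: "irreducible_cubic \<Gamma>"
  obtains T where "T \<subseteq> points_on A \<Gamma>" "card T \<le> 13"
    "visibly_colourable A (points_on A \<Gamma> - T) (15 * (card (A - points_on A \<Gamma>) + 1))"
proof -
  obtain F where F: "irreducible F" "homogeneous3 3 F" "\<Gamma> = zero_locus F"
    using \<Gamma> unfolding irreducible_projective_curve_def by blast
  obtain k30 k21 k12 k03 k20 k11 k02 k10 k01 k00 where
    k: "\<And>x y. eval3 F (vector [x, y, 1]) = k30 * x ^ 3 + k21 * x\<^sup>2 * y + k12 * x * y\<^sup>2 + k03 * y ^ 3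
    + k20 * x\<^sup>2 + k11 * x * y + k02 * y\<^sup>2 + k10 * x + k01 * y + k00"
    using cubic_form_affine[OF F(2)] by blast
  let ?S = "points_on A \<Gamma>" and ?Z = "{p. of_affine p \<in> \<Gamma>}"
  have Z: "of_affine p \<in> \<Gamma> \<longleftrightarrow> eval3 F (vector [p $ 1, p $ 2, 1]) = 0" for p
    unfolding F(3) by (rule of_affine_in_zero_locus[OF F(2)])
  have S: "finite ?S" using A by (simp add: points_on_def)
  have "arc_colourable 13 15 ?Z ?S"
    unfolding Z k
  proof (rule arc_colourable_cubic[OF S])
    show "finite {t. k30 * (p1 + t * d1) ^ 3 + k21 * (p1 + t * d1)\<^sup>2 * (p2 + t * d2)
        + k12 * (p1 + t * d1) * (p2 + t * d2)\<^sup>2 + k03 * (p2 + t * d2) ^ 3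
        + k20 * (p1 + t * d1)\<^sup>2 + k11 * (p1 + t * d1) * (p2 + t * d2) + k02 * (p2 + t * d2)\<^sup>2
        + k10 * (p1 + t * d1) + k01 * (p2 + t * d2) + k00 = 0}"
      if "d1 \<noteq> 0 \<or> d2 \<noteq> 0" for p1 p2 d1 d2
      unfolding k[symmetric] by (rule irreducible_finite_on_line[OF F(1,2) _ that]) simp
  qed (auto simp: points_on_def Z k[symmetric])
  then obtain T c where T: "T \<subseteq> ?S" "card T \<le> 13" "\<forall>p \<in> ?S - T. c p < (15 :: nat)"
    "\<forall>p \<in> ?S - T. \<forall>q \<in> ?S - T. p \<noteq> q \<longrightarrow> c p = c q \<longrightarrow> open_segment p q \<inter> ?Z = {}"
    unfolding arc_colourable_def by (elim exE conjE)
  let ?X = "\<lambda>i. {p \<in> ?S - T. c p = i}"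
  have "visibly_colourable A (?X i) (Suc (card (A - ?S)))" for i
  proof (rule visibly_colourable_off_curve[OF A, where Z = ?Z])
    show "?X i \<subseteq> A" "?X i \<subseteq> ?Z" by (auto simp: points_on_def)
    show "open_segment p q \<inter> ?Z = {}" if pq: "p \<in> ?X i" "q \<in> ?X i" "p \<noteq> q" for p q
    proof -
      have "p \<in> ?S - T" "q \<in> ?S - T" "c p = c q" using pq by simp_all
      then show ?thesis using T(4)[rule_format, of p q] pq(3) by simp
    qed
    show "card (A - ?Z) \<le> card (A - ?S)"
      using A by (intro card_mono) (auto simp: points_on_def)
  qed
  then have "visibly_colourable A (\<Union>i < 15. ?X i) (15 * Suc (card (A - ?S)))"
    by (rule visibly_colourable_UN)
  moreover have "(\<Union>i < 15. ?X i) = ?S - T" using T(3) by auto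
  ultimately show ?thesis using T(1,2) by (intro that[of T]) simp_all
qed

lemma projective_cubic_cases:
  assumes "projective_cubic \<Gamma>"
  obtains "irreducible_cubic \<Gamma>"
  | Q L where "irreducible_conic Q" "projective_line L" "\<Gamma> = Q \<union> L"
  | L1 L2 L3 where "projective_line L1" "projective_line L2" "projective_line L3" "\<Gamma> = L1 \<union> L2 \<union> L3"
proof -
  obtain F where F: "F \<noteq> 0" "homogeneous3 3 F" "\<Gamma> = zero_locus F"
    using assms unfolding projective_curve_def by blast
  show ?thesis
  proof (cases "irreducible F")
    case True
    then have "irreducible_cubic \<Gamma>" using F unfolding irreducible_projective_curve_def by blast
    then show ?thesis by (rule that(1))
  next
    case False
    obtain G H i j where GH: "F = G * H" "homogeneous3 i G" "homogeneous3 j H" "i + j = 3" "i > 0" "j > 0"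
      by (rule reducible_form_factors[OF False F(1,2) zero_less_numeral]) (rule that)
    have "\<exists>K M. homogeneous3 2 K \<and> homogeneous3 1 M \<and> K \<noteq> 0 \<and> M \<noteq> 0 \<and> \<Gamma> = zero_locus K \<union> zero_locus M"
    proof -
      have "\<Gamma> = zero_locus G \<union> zero_locus H" "\<Gamma> = zero_locus H \<union> zero_locus G" "G \<noteq> 0" "H \<noteq> 0"
        using zero_locus_mult[OF GH(2,3), of 3] F GH(1) by auto
      moreover have "i = 2 \<and> j = 1 \<or> i = 1 \<and> j = 2" using GH(4-6) by linarith
      ultimately show ?thesis using GH(2,3) by blast
    qed
    then obtain K M where K: "homogeneous3 2 K" "K \<noteq> 0" and M: "homogeneous3 1 M" "M \<noteq> 0"
      and \<Gamma>: "\<Gamma> = zero_locus K \<union> zero_locus M" by blast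
    have line: "projective_line (zero_locus M)" using M unfolding projective_curve_def by blast
    show ?thesis
    proof (cases "irreducible K")
      case True
      then have "irreducible_conic (zero_locus K)"
        using K unfolding irreducible_projective_curve_def by blast
      then show ?thesis using line \<Gamma> by (rule that(2))
    next
      case False
      obtain G H i j where GH: "K = G * H" "homogeneous3 i G" "homogeneous3 j H" "i + j = 2" "i > 0" "j > 0"
        by (rule reducible_form_factors[OF False K(2,1) zero_less_numeral]) (rule that)
      then have "i = 1" "j = 1" by linarith+
      moreover have "G \<noteq> 0" "H \<noteq> 0" using K(2) GH(1) by auto
      ultimately have "projective_line (zero_locus G)" "projective_line (zero_locus H)"
        using GH(2,3) unfolding projective_curve_def by blast+
      moreover have "\<Gamma> = zero_locus G \<union> zero_locus H \<union> zero_locus M"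
        using zero_locus_mult[OF GH(2,3), of 2] K(1) GH(1) \<Gamma> by simp
      ultimately show ?thesis using line by (intro that(3))
    qed
  qed
qed

theorem theorem6p1:
  fixes A :: "(real ^ 2) set" and \<Gamma> :: "rp2 set" and k n s m :: nat
  assumes "finite A" and "card A = n"
    and "k \<ge> 2"
    and "\<not> (\<exists>B \<subseteq> A. card B = k \<and> collinear B)"
    and "projective_cubic \<Gamma>"
    and "s = card (A - points_on A \<Gamma>)"
    and "m = card (points_on A \<Gamma>)"
    and "m > 3 * (k - 1)"
  shows "real m = real n - real s
    \<and> \<not> (\<exists>L1 L2 L3. projective_line L1 \<and> projective_line L2 \<and> projective_line L3
          \<and> \<Gamma> = L1 \<union> L2 \<union> L3)
    \<and> (\<forall>Q L a. irreducible_conic Q \<and> projective_line L \<and> \<Gamma> = Q \<union> L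
          \<and> a = card (points_on A L) \<longrightarrow>
          visible_partition_number A (points_on A Q) \<le> s + a + 1
        \<and> real (clique_number (visibility_graph A))
            \<ge> real (card (points_on A Q)) / (real s + real a + 1)
        \<and> real (card (points_on A Q)) / (real s + real a + 1)
            \<ge> (real n - real s - (real k - 1)) / (real s + real k)
        \<and> (\<exists>P. visible_partition A (points_on A \<Gamma>) P \<and> card P \<le> s + 2 * a + 1)
        \<and> s + 2 * a + 1 \<le> s + 2 * k - 1)
    \<and> (irreducible_cubic \<Gamma> \<longrightarrow>
          (\<exists>P. visible_partition A (points_on A \<Gamma>) P \<and> card P \<le> 15 * (s + 1) + 13)
        \<and> real (clique_number (visibility_graph A))
            \<ge> (real n - real s - 13) / (15 * (real s + 1)))
    \<and> real (clique_number (visibility_graph A))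
        \<ge> max 1 (min ((real n - real s - (real k - 1)) / (real s + real k))
                      ((real n - real s - 13) / (15 * (real s + 1))))"
proof -
  define \<omega> where "\<omega> = clique_number (visibility_graph A)"
  have sub: "points_on A C \<subseteq> A" for C by (auto simp: points_on_def)
  have fin: "finite (points_on A C)" for C using sub assms(1) by (rule finite_subset)
  have line: "card (points_on A L) \<le> k - 1" if "projective_line L" for L
    using card_points_on_line_less[OF assms(1,4) that] by simp
  have nms: "n = m + s"
    using card_Diff_subset[OF fin sub, of \<Gamma>] card_mono[OF assms(1) sub, of \<Gamma>] assms(2,6,7)
    by linarith
  have 1: "real m = real n - real s" using nms by simp
  have 2: "\<not> (\<exists>L1 L2 L3. projective_line L1 \<and> projective_line L2 \<and> projective_line L3
      \<and> \<Gamma> = L1 \<union> L2 \<union> L3)"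
  proof clarify
    fix L1 L2 L3 assume L: "projective_line L1" "projective_line L2" "projective_line L3"
      and \<Gamma>: "\<Gamma> = L1 \<union> L2 \<union> L3"
    have "m \<le> card (points_on A L1) + card (points_on A L2) + card (points_on A L3)"
      unfolding assms(7) \<Gamma> points_on_Un
      by (rule order.trans[OF card_Un_le]) (simp add: card_Un_le)
    with line[OF L(1)] line[OF L(2)] line[OF L(3)] assms(8) show False by linarith
  qed
  have 3: "visible_partition_number A (points_on A Q) \<le> s + a + 1
        \<and> real \<omega> \<ge> real (card (points_on A Q)) / (real s + real a + 1)
        \<and> real (card (points_on A Q)) / (real s + real a + 1)
            \<ge> (real n - real s - (real k - 1)) / (real s + real k)
        \<and> (\<exists>P. visible_partition A (points_on A \<Gamma>) P \<and> card P \<le> s + 2 * a + 1)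
        \<and> s + 2 * a + 1 \<le> s + 2 * k - 1"
    if Q: "irreducible_conic Q" and L: "projective_line L" and \<Gamma>: "\<Gamma> = Q \<union> L"
      and a: "a = card (points_on A L)" for Q L a
  proof -
    have col: "visibly_colourable A (points_on A Q) (s + a + 1)"
      using visibly_colourable_conic[OF assms(1) Q, of L] by (simp add: assms(6) \<Gamma> a)
    have "a \<le> k - 1" using line[OF L] a by simp
    then have ak: "real a + 1 \<le> real k" "s + 2 * a + 1 \<le> s + 2 * k - 1" using assms(3) by linarith+
    have num: "visible_partition_number A (points_on A Q) \<le> s + a + 1"
      by (rule visible_partition_number_le[OF col fin sub])
    have "card (points_on A Q) \<le> (s + a + 1) * \<omega>"
      unfolding \<omega>_def by (rule card_le_clique_number[OF col assms(1) sub])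
    then have "real (card (points_on A Q)) \<le> (real s + real a + 1) * real \<omega>"
      by (metis of_nat_1 of_nat_add of_nat_le_iff of_nat_mult)
    then have clique: "real \<omega> \<ge> real (card (points_on A Q)) / (real s + real a + 1)"
      by (simp add: divide_le_eq mult.commute)
    have "m \<le> card (points_on A Q) + a"
      unfolding assms(7) \<Gamma> points_on_Un a by (rule card_Un_le)
    then have "real n - real s - (real k - 1) \<le> real (card (points_on A Q))"
      using ak(1) 1 by linarith
    then have frac: "real (card (points_on A Q)) / (real s + real a + 1)
        \<ge> (real n - real s - (real k - 1)) / (real s + real k)"
      using ak(1) by (intro frac_le) linarith+
    \<comment> \<open>Giving each point of the line its own colour adds another \<open>a\<close>,
      whence \<open>2 * a\<close>.\<close>
    have "visibly_colourable A (points_on A Q \<union> points_on A L) (s + a + 1 + a)"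
      unfolding a by (rule visibly_colourable_Un[OF col[unfolded a] visibly_colourable_card[OF fin]])
    then have "visibly_colourable A (points_on A \<Gamma>) (s + 2 * a + 1)"
      by (simp add: \<Gamma> points_on_Un mult_2 add_ac)
    from visibly_colourable_partition[OF this fin sub]
    have "\<exists>P. visible_partition A (points_on A \<Gamma>) P \<and> card P \<le> s + 2 * a + 1" by blast
    with num clique frac ak(2) show ?thesis by blast
  qed
  have 4: "(\<exists>P. visible_partition A (points_on A \<Gamma>) P \<and> card P \<le> 15 * (s + 1) + 13)
        \<and> real \<omega> \<ge> (real n - real s - 13) / (15 * (real s + 1))"
    if cubic: "irreducible_cubic \<Gamma>"
  proof -
    obtain T where T: "T \<subseteq> points_on A \<Gamma>" "card T \<le> 13"
      "visibly_colourable A (points_on A \<Gamma> - T) (15 * (s + 1))"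
      by (rule visibly_colourable_irreducible_cubic[OF assms(1) cubic, folded assms(6)]) (rule that)
    have finT: "finite T" using T(1) fin by (rule finite_subset)
    have "visibly_colourable A (points_on A \<Gamma> - T \<union> T) (15 * (s + 1) + card T)"
      by (rule visibly_colourable_Un[OF T(3) visibly_colourable_card[OF finT]])
    moreover have "points_on A \<Gamma> - T \<union> T = points_on A \<Gamma>" using T(1) by blast
    ultimately have "visibly_colourable A (points_on A \<Gamma>) (15 * (s + 1) + card T)" by simp
    then obtain P where "visible_partition A (points_on A \<Gamma>) P" "card P \<le> 15 * (s + 1) + card T"
      using visibly_colourable_partition[OF _ fin sub] by metis
    then have part: "\<exists>P. visible_partition A (points_on A \<Gamma>) P \<and> card P \<le> 15 * (s + 1) + 13"
      using T(2) by (meson add_left_mono order.trans)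
    \<comment> \<open>Only the points outside \<open>T\<close> are counted, so 13 is subtracted from
      the numerator and not added to the number of classes.\<close>
    have "card (points_on A \<Gamma> - T) \<le> 15 * (s + 1) * \<omega>"
      unfolding \<omega>_def by (rule card_le_clique_number[OF T(3) assms(1)]) (use sub in blast)
    moreover have "m \<le> card (points_on A \<Gamma> - T) + 13"
      using card_Diff_subset[OF finT T(1)] T(2) assms(7) by linarith
    ultimately have "m \<le> 15 * (s + 1) * \<omega> + 13" by linarith
    then have "real m \<le> real (15 * (s + 1) * \<omega> + 13)" by (simp only: of_nat_le_iff)
    then have "real n - real s - 13 \<le> real \<omega> * (15 * (real s + 1))"
      using 1 by (simp add: algebra_simps)
    with part show ?thesis by (simp add: divide_le_eq)
  qed
  have "m > 0" using assms(8) by linarith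
  then obtain p where "p \<in> A" using sub assms(7) by (metis card_gt_0_iff ex_in_conv subsetD)
  then have "mutually_visible A {p}" by (simp add: mutually_visible_def)
  from card_mutually_visible_le[OF assms(1) this] have one: "real \<omega> \<ge> 1" by (simp add: \<omega>_def)
  have 5: "real \<omega> \<ge> max 1 (min ((real n - real s - (real k - 1)) / (real s + real k))
                      ((real n - real s - 13) / (15 * (real s + 1))))"
    using assms(5)
  proof (cases rule: projective_cubic_cases)
    case 1
    with 4 one show ?thesis by linarith
  next
    case (2 Q L)
    from 3[OF this refl] one show ?thesis by linarith
  next
    case (3 L1 L2 L3)
    with 2 show ?thesis by blast
  qed
  show ?thesis
    using 1 2 3 4 5 unfolding \<omega>_def by blast
qed

end
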